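(* Let $n\geq 3$ be an integer, and let $q,a\in\mathbb{R}$ satisfy $1<q<\frac{n}{n-2}$ and $0<a\leq \frac{n-2}{2}$. If $u\in C^{\infty}(\overline{\mathbb{B}^{n}})$ is positive on $\overline{\mathbb{B}^{n}}$ and satisfies $$\Delta u=0 \ \text{ on } \mathbb{B}^{n},\qquad \frac{\partial u}{\partial \nu}+au=u^{q}\ \text{ on } \mathbb{S}^{n-1},$$ then $u$ is constant.
   Context: $\mathbb{B}^{n}\subset\mathbb{R}^n$ is the open unit ball, $\overline{\mathbb{B}^{n}}$ its closure, $\mathbb{S}^{n-1}=\partial\mathbb{B}^n$ the unit sphere, $\Delta$ the Euclidean Laplacian, and $\nu$ the outer unit normal on $\mathbb{S}^{n-1}$. $C^\infty(\overline{\mathbb{B}^n})$ denotes the real-valued functions smooth up to the boundary. *)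

theory Defs
  imports "HOL-Analysis.Analysis"
begin

definition partial_deriv :: "'n::finite \<Rightarrow> (real ^ 'n \<Rightarrow> real) \<Rightarrow> real ^ 'n \<Rightarrow> real" where
  "partial_deriv i f x = frechet_derivative f (at x) (axis i 1)"

definition laplacian :: "(real ^ 'n::finite \<Rightarrow> real) \<Rightarrow> real ^ 'n \<Rightarrow> real" where
  "laplacian f x = (\<Sum>i\<in>UNIV. partial_deriv i (partial_deriv i f) x)"

(* Meant for open S: the derivatives are taken in the full space. *)
primrec Ck_on :: "nat \<Rightarrow> (real ^ 'n::finite \<Rightarrow> real) \<Rightarrow> (real ^ 'n) set \<Rightarrow> bool" where
  "Ck_on 0 f S \<longleftrightarrow> continuous_on S f"
| "Ck_on (Suc k) f S \<longleftrightarrow>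
     (\<forall>x\<in>S. f differentiable (at x)) \<and> (\<forall>i. Ck_on k (partial_deriv i f) S)"

definition smooth_on_open :: "(real ^ 'n::finite \<Rightarrow> real) \<Rightarrow> (real ^ 'n) set \<Rightarrow> bool" where
  "smooth_on_open f S \<longleftrightarrow> open S \<and> (\<forall>k. Ck_on k f S)"

(* Smoothness up to the boundary: the restriction of u to the closed unit ball extends smoothly
   to a neighbourhood of it.  The values of u outside the closed ball are irrelevant. *)
definition smooth_on_closed_ball :: "(real ^ 'n::finite \<Rightarrow> real) \<Rightarrow> bool" where
  "smooth_on_closed_ball u \<longleftrightarrow>
     (\<exists>S v. cball 0 1 \<subseteq> S \<and> smooth_on_open v S \<and> (\<forall>x\<in>cball 0 1. v x = u x))"

(* The outer unit normal of the unit sphere at x is x itself.  The derivative in that direction is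
   taken from inside, so that it depends only on the values of u on the closed ball. *)
definition outer_normal_deriv :: "(real ^ 'n::finite \<Rightarrow> real) \<Rightarrow> real ^ 'n \<Rightarrow> real" where
  "outer_normal_deriv u x = vector_derivative (\<lambda>t. u (t *\<^sub>R x)) (at 1 within {0..1})"

lemma outer_normal_deriv_extension:
  fixes u v :: "real ^ 'n::finite \<Rightarrow> real"
  assumes x: "x \<in> sphere 0 1" and v: "v differentiable (at x)"
    and eq: "\<And>y. y \<in> cball 0 1 \<Longrightarrow> v y = u y"
  shows "outer_normal_deriv u x = frechet_derivative v (at x) x"
proof -
  have "(v has_derivative frechet_derivative v (at x)) (at x)"
    using v by (simp add: frechet_derivative_works)
  moreover have "((\<lambda>t. t *\<^sub>R x) has_vector_derivative x) (at 1 within {0..1})"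
    by (auto intro!: derivative_eq_intros simp: has_vector_derivative_def)
  ultimately have "((v \<circ> (\<lambda>t. t *\<^sub>R x)) has_vector_derivative frechet_derivative v (at x) x)
      (at 1 within {0..1})"
    by (intro vector_derivative_diff_chain_within) (auto intro: has_derivative_at_withinI)
  then have "((\<lambda>t. u (t *\<^sub>R x)) has_vector_derivative frechet_derivative v (at x) x)
      (at 1 within {0..1})"
    by (rule has_vector_derivative_transform[rotated 2]) (use x eq in auto)
  then show ?thesis
    unfolding outer_normal_deriv_def
    by (intro vector_derivative_within_closed_interval) auto
qed

end

theory Submission
  imports Defs
begin

text \<open>
  The proof is by the method of moving spheres and uses no integration. Put \<open>m = (n - 2) / 2\<close>.
  For a unit vector \<open>p\<close> and \<open>0 < \<kappa> < 1\<close> consider the sphere with centre \<open>p / \<kappa>\<close> that is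
  orthogonal to the unit sphere. Inversion in it preserves the unit ball, so the Kelvin transform
  of \<open>u\<close> is again a positive harmonic function on the ball (\<open>has_grad_lap_kelvin\<close>). The boundary
  operator \<open>\<partial>\<^sub>\<nu> + m\<close> is conformally covariant, so the Kelvin transform satisfies the boundary condition of
  \<open>u\<close> with two coefficients changed into positive powers of the conformal factor of the inversion; the
  powers are positive because \<open>q < n / (n - 2)\<close>, and the coefficients have the right sign because
  \<open>a \<le> m\<close> (\<open>excess_diff\<close>). Outside the mirror sphere the conformal factor is less than one.

  The claim is that outside the mirror \<open>u\<close> is at least its Kelvin transform, for every \<open>\<kappa>\<close>
  (\<open>dominates_all\<close>). It holds for \<open>\<kappa>\<close> close to 1, when the mirror is tiny (\<open>dominates_start\<close>).
  As \<open>\<kappa>\<close> decreases it cannot cease to hold: by the strong minimum principle and the boundary condition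
  the inequality is strict off the mirror (\<open>dominates_strict\<close>), and next to the mirror a barrier with
  large normal derivative on the unit sphere controls the linearized boundary condition for all
  nearby \<open>\<kappa>\<close>, including at the corner where mirror and sphere meet (\<open>barrier\<close>, \<open>dominates_open\<close>).

  As \<open>\<kappa>\<close> tends to 0 the mirrors tend to the hyperplane through the origin orthogonal to \<open>p\<close>, and the
  inequality becomes \<open>u x \<ge> u (x - 2 (p \<bullet> x) p)\<close> whenever \<open>p \<bullet> x \<le> 0\<close>. Any two points of
  the sphere are exchanged by such a reflection, in either role, so \<open>u\<close> is constant on the sphere
  (\<open>U_sphere_le\<close>) and then on the ball, by the minimum principle.
\<close>

section \<open>Pointwise gradients and Laplacians\<close>

text \<open>
  Laplacian arguments below only ever need the gradient and the trace of the Hessian at one point, so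
  these two values are bundled into one relation. The Hessian is the derivative of a gradient field
  given as a vector field.
\<close>
definition has_grad_lap :: "('a::euclidean_space \<Rightarrow> real) \<Rightarrow> 'a \<Rightarrow> real \<Rightarrow> 'a \<Rightarrow> bool" where
  "has_grad_lap f g L x \<longleftrightarrow> (\<exists>G G'. (\<forall>\<^sub>F y in nhds x. (f has_derivative (\<lambda>h. G y \<bullet> h)) (at y))
     \<and> (G has_derivative G') (at x) \<and> G x = g \<and> L = (\<Sum>i\<in>Basis. G' i \<bullet> i))"

lemma has_grad_lapI:
  assumes "\<forall>\<^sub>F y in nhds x. (f has_derivative (\<lambda>h. G y \<bullet> h)) (at y)"
    "(G has_derivative G') (at x)" "G x = g" "L = (\<Sum>i\<in>Basis. G' i \<bullet> i)"
  shows "has_grad_lap f g L x"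
  using assms unfolding has_grad_lap_def by blast

lemma has_grad_lap_imp_has_derivative:
  assumes "has_grad_lap f g L x"
  shows "(f has_derivative (\<lambda>h. g \<bullet> h)) (at x)"
  using assms eventually_nhds_x_imp_x unfolding has_grad_lap_def by fastforce

lemma has_grad_lap_transform:
  assumes "has_grad_lap f g L x" "open S" "x \<in> S" "\<And>y. y \<in> S \<Longrightarrow> f y = h y"
  shows "has_grad_lap h g L x"
proof -
  obtain G D where 1: "\<forall>\<^sub>F y in nhds x. (f has_derivative (\<lambda>h. G y \<bullet> h)) (at y)"
    "(G has_derivative D) (at x)" "G x = g" "L = (\<Sum>i\<in>Basis. D i \<bullet> i)"
    using assms(1) unfolding has_grad_lap_def by blast
  have "\<forall>\<^sub>F y in nhds x. y \<in> S" using assms eventually_nhds by blast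
  then have "\<forall>\<^sub>F y in nhds x. (h has_derivative (\<lambda>h. G y \<bullet> h)) (at y)"
    using 1(1)
    by eventually_elim (use assms has_derivative_transform_within_open in blast)
  then show ?thesis using 1 has_grad_lapI by blast
qed

lemma has_grad_lap_const: "has_grad_lap (\<lambda>x. c) 0 0 x"
  by (rule has_grad_lapI[where G="\<lambda>_. 0" and G'="\<lambda>_. 0"]) auto

lemma has_grad_lap_inner: "has_grad_lap (\<lambda>x. b \<bullet> x) b 0 x"
  by (rule has_grad_lapI[where G="\<lambda>_. b" and G'="\<lambda>_. 0"])
     (auto intro!: derivative_eq_intros always_eventually)

lemma sum_Basis_inner_self: "(\<Sum>i\<in>Basis. (i::'a::euclidean_space) \<bullet> i) = real DIM('a)"
  by (simp add: inner_same_Basis)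

lemma has_grad_lap_norm_sq:
  fixes c x :: "'a::euclidean_space"
  shows "has_grad_lap (\<lambda>x. (x - c) \<bullet> (x - c)) (2 *\<^sub>R (x - c)) (2 * real DIM('a)) x"
  by (rule has_grad_lapI[where G="\<lambda>x. 2 *\<^sub>R (x - c)" and G'="\<lambda>h. 2 *\<^sub>R h"])
     (auto intro!: derivative_eq_intros always_eventually simp: inner_commute)

lemma has_grad_lap_add:
  assumes "has_grad_lap f g L x" "has_grad_lap f' g' L' x"
  shows "has_grad_lap (\<lambda>x. f x + f' x) (g + g') (L + L') x"
proof -
  obtain G D where 1: "\<forall>\<^sub>F y in nhds x. (f has_derivative (\<lambda>h. G y \<bullet> h)) (at y)"
    "(G has_derivative D) (at x)" "G x = g" "L = (\<Sum>i\<in>Basis. D i \<bullet> i)"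
    using assms(1) unfolding has_grad_lap_def by blast
  obtain G1 D1 where 2: "\<forall>\<^sub>F y in nhds x. (f' has_derivative (\<lambda>h. G1 y \<bullet> h)) (at y)"
    "(G1 has_derivative D1) (at x)" "G1 x = g'" "L' = (\<Sum>i\<in>Basis. D1 i \<bullet> i)"
    using assms(2) unfolding has_grad_lap_def by blast
  show ?thesis
  proof (rule has_grad_lapI)
    show "\<forall>\<^sub>F y in nhds x. ((\<lambda>x. f x + f' x) has_derivative (\<lambda>h. (G y + G1 y) \<bullet> h)) (at y)"
      using 1(1) 2(1) by eventually_elim (auto intro!: derivative_eq_intros simp: inner_add_left)
    show "((\<lambda>y. G y + G1 y) has_derivative (\<lambda>h. D h + D1 h)) (at x)"
      using 1(2) 2(2) by (rule has_derivative_add)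
  qed (use 1 2 in \<open>auto simp: inner_add_left sum.distrib\<close>)
qed

lemma has_grad_lap_mult:
  assumes "has_grad_lap f g L x" "has_grad_lap f' g' L' x"
  shows "has_grad_lap (\<lambda>x. f x * f' x) (f x *\<^sub>R g' + f' x *\<^sub>R g)
           (f x * L' + f' x * L + 2 * (g \<bullet> g')) x"
proof -
  obtain G D where 1: "\<forall>\<^sub>F y in nhds x. (f has_derivative (\<lambda>h. G y \<bullet> h)) (at y)"
    "(G has_derivative D) (at x)" "G x = g" "L = (\<Sum>i\<in>Basis. D i \<bullet> i)"
    using assms(1) unfolding has_grad_lap_def by blast
  obtain G1 D1 where 2: "\<forall>\<^sub>F y in nhds x. (f' has_derivative (\<lambda>h. G1 y \<bullet> h)) (at y)"
    "(G1 has_derivative D1) (at x)" "G1 x = g'" "L' = (\<Sum>i\<in>Basis. D1 i \<bullet> i)"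
    using assms(2) unfolding has_grad_lap_def by blast
  note d = assms[THEN has_grad_lap_imp_has_derivative]
  show ?thesis
  proof (rule has_grad_lapI)
    show "\<forall>\<^sub>F y in nhds x. ((\<lambda>x. f x * f' x) has_derivative
             (\<lambda>h. (f y *\<^sub>R G1 y + f' y *\<^sub>R G y) \<bullet> h)) (at y)"
      using 1(1) 2(1) by eventually_elim
        (auto intro!: derivative_eq_intros simp: inner_add_left algebra_simps)
    show "((\<lambda>y. f y *\<^sub>R G1 y + f' y *\<^sub>R G y) has_derivative
        (\<lambda>h. (f x *\<^sub>R D1 h + (g \<bullet> h) *\<^sub>R G1 x) + (f' x *\<^sub>R D h + (g' \<bullet> h) *\<^sub>R G x))) (at x)"
      by (intro has_derivative_add has_derivative_scaleR d 1 2)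
    show "f x * L' + f' x * L + 2 * (g \<bullet> g') = (\<Sum>i\<in>Basis.
       ((f x *\<^sub>R D1 i + (g \<bullet> i) *\<^sub>R G1 x) + (f' x *\<^sub>R D i + (g' \<bullet> i) *\<^sub>R G x)) \<bullet> i)"
      using 1 2 by (simp add: inner_add_left sum.distrib sum_distrib_left
         euclidean_inner[of g g'] algebra_simps)
  qed (use 1 2 in auto)
qed

lemma has_grad_lap_cmult:
  assumes "has_grad_lap f g L x"
  shows "has_grad_lap (\<lambda>x. c * f x) (c *\<^sub>R g) (c * L) x"
  using has_grad_lap_mult[OF has_grad_lap_const assms, of c] by simp

lemma has_grad_lap_diff:
  assumes "has_grad_lap f g L x" "has_grad_lap f' g' L' x"
  shows "has_grad_lap (\<lambda>x. f x - f' x) (g - g') (L - L') x"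
  using has_grad_lap_add[OF assms(1) has_grad_lap_cmult[OF assms(2), of "-1"]] by simp

lemma has_grad_lap_compose:
  assumes f: "has_grad_lap f g L x"
    and \<phi>: "\<forall>\<^sub>F t in nhds (f x). (\<phi> has_real_derivative \<phi>' t) (at t)"
    and \<phi>': "(\<phi>' has_real_derivative \<phi>'') (at (f x))"
  shows "has_grad_lap (\<lambda>x. \<phi> (f x)) (\<phi>' (f x) *\<^sub>R g) (\<phi>' (f x) * L + \<phi>'' * (g \<bullet> g)) x"
proof -
  obtain G D where 1: "\<forall>\<^sub>F y in nhds x. (f has_derivative (\<lambda>h. G y \<bullet> h)) (at y)"
    "(G has_derivative D) (at x)" "G x = g" "L = (\<Sum>i\<in>Basis. D i \<bullet> i)"
    using assms(1) unfolding has_grad_lap_def by blast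
  note d = has_grad_lap_imp_has_derivative[OF f]
  have "isCont f x" using d has_derivative_continuous by blast
  then have ev: "\<forall>\<^sub>F y in nhds x. (\<phi> has_real_derivative \<phi>' (f y)) (at (f y))"
    using eventually_compose_filterlim[OF \<phi>] by (simp add: isCont_def tendsto_at_iff_tendsto_nhds)
  have 2: "((\<lambda>y. \<phi>' (f y)) has_derivative (\<lambda>h. (g \<bullet> h) * \<phi>'')) (at x)"
    using has_derivative_compose[OF d \<phi>'[unfolded has_field_derivative_def]]
    by (simp add: mult.commute)
  show ?thesis
  proof (rule has_grad_lapI)
    show "\<forall>\<^sub>F y in nhds x. ((\<lambda>x. \<phi> (f x)) has_derivative (\<lambda>h. (\<phi>' (f y) *\<^sub>R G y) \<bullet> h)) (at y)"
      using 1(1) ev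
    proof eventually_elim
      case (elim y)
      show ?case
        using has_derivative_compose[OF elim(1) elim(2)[unfolded has_field_derivative_def]] by simp
    qed
    show "((\<lambda>y. \<phi>' (f y) *\<^sub>R G y) has_derivative (\<lambda>h. \<phi>' (f x) *\<^sub>R D h + ((g \<bullet> h) * \<phi>'') *\<^sub>R G x)) (at x)"
      by (intro has_derivative_scaleR 1 2)
    show "\<phi>' (f x) * L + \<phi>'' * (g \<bullet> g) = (\<Sum>i\<in>Basis. (\<phi>' (f x) *\<^sub>R D i + ((g \<bullet> i) * \<phi>'') *\<^sub>R G x) \<bullet> i)"
      using 1 by (simp add: inner_add_left sum.distrib sum_distrib_left
         euclidean_inner[of g g] algebra_simps)
  qed (use 1 in auto)
qed

lemma has_grad_lap_exp_norm_sq: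
  fixes c x :: "'a::euclidean_space"
  shows "has_grad_lap (\<lambda>x. exp (k * ((x - c) \<bullet> (x - c) - b)))
     ((2 * k * exp (k * ((x - c) \<bullet> (x - c) - b))) *\<^sub>R (x - c))
     (exp (k * ((x - c) \<bullet> (x - c) - b)) * (2 * k * DIM('a) + 4 * k\<^sup>2 * ((x - c) \<bullet> (x - c)))) x"
proof -
  have "has_grad_lap (\<lambda>x. exp (k * ((x - c) \<bullet> (x - c) - b)))
     ((k * exp (k * ((x - c) \<bullet> (x - c) - b))) *\<^sub>R (2 *\<^sub>R (x - c)))
     ((k * exp (k * ((x - c) \<bullet> (x - c) - b))) * (2 * real DIM('a))
       + (k\<^sup>2 * exp (k * ((x - c) \<bullet> (x - c) - b))) * ((2 *\<^sub>R (x - c)) \<bullet> (2 *\<^sub>R (x - c)))) x"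
    by (rule has_grad_lap_compose[OF has_grad_lap_norm_sq[of c x], where \<phi>="\<lambda>t. exp (k * (t - b))"
          and \<phi>'="\<lambda>t. k * exp (k * (t - b))"])
       (auto intro!: derivative_eq_intros always_eventually simp: power2_eq_square)
  moreover have "(2 *\<^sub>R (x - c)) \<bullet> (2 *\<^sub>R (x - c)) = 4 * ((x - c) \<bullet> (x - c))" by simp
  moreover have "(k * e) *\<^sub>R (2 *\<^sub>R v) = (2 * k * e) *\<^sub>R v"
    "(k * e) * (2 * d) + (k\<^sup>2 * e) * (4 * s) = e * (2 * k * d + 4 * k\<^sup>2 * s)" for e d s and v :: 'a
    by (simp_all add: algebra_simps)
  ultimately show ?thesis by (simp only:)
qed

text \<open>
  The second derivative test: at a local minimum every diagonal entry of the Hessian is nonnegative.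
\<close>
lemma has_grad_lap_local_min:
  fixes x :: "'a::euclidean_space"
  assumes f: "has_grad_lap f g L x" and min: "\<forall>\<^sub>F y in nhds x. f x \<le> f y"
  shows "0 \<le> L"
proof -
  obtain G D where 1: "\<forall>\<^sub>F y in nhds x. (f has_derivative (\<lambda>h. G y \<bullet> h)) (at y)"
    "(G has_derivative D) (at x)" "G x = g" "L = (\<Sum>i\<in>Basis. D i \<bullet> i)"
    using assms(1) unfolding has_grad_lap_def by blast
  have "0 \<le> D i \<bullet> i" for i
  proof (rule ccontr)
    assume neg: "\<not> ?thesis"
    define h where "h = (\<lambda>t. f (x + t *\<^sub>R i))"
    have "((\<lambda>t. x + t *\<^sub>R i) \<longlongrightarrow> x + 0 *\<^sub>R i) (nhds (0::real))"
      by (intro tendsto_add tendsto_const tendsto_scaleR filterlim_ident)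
    then have line: "((\<lambda>t. x + t *\<^sub>R i) \<longlongrightarrow> x) (nhds (0::real))" by simp
    have "\<forall>\<^sub>F t in nhds 0. (f has_derivative (\<lambda>h. G (x + t *\<^sub>R i) \<bullet> h)) (at (x + t *\<^sub>R i)) \<and> f x \<le> h t"
      unfolding h_def using eventually_compose_filterlim[OF eventually_conj[OF 1(1) min] line] .
    then obtain d where d: "d > 0" and near: "\<And>t. \<bar>t\<bar> < d \<Longrightarrow>
        (f has_derivative (\<lambda>h. G (x + t *\<^sub>R i) \<bullet> h)) (at (x + t *\<^sub>R i)) \<and> f x \<le> h t"
      by (auto simp: eventually_nhds_metric dist_real_def)
    have h': "(h has_real_derivative G (x + t *\<^sub>R i) \<bullet> i) (at t)" if "\<bar>t\<bar> < d" for t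
    proof -
      have "((\<lambda>t. x + t *\<^sub>R i) has_derivative (\<lambda>s. s *\<^sub>R i)) (at t)"
        by (auto intro!: derivative_eq_intros)
      from has_derivative_compose[OF this conjunct1[OF near[OF that]]] show ?thesis
        unfolding h_def has_field_derivative_def by (simp add: mult_commute_abs)
    qed
    have h0: "G x \<bullet> i = 0"
      using DERIV_local_min[OF h'[of 0] d] near d by (simp add: h_def)
    have "((\<lambda>t. G (x + t *\<^sub>R i) \<bullet> i) has_real_derivative D i \<bullet> i) (at 0)"
    proof -
      have "((\<lambda>t. x + t *\<^sub>R i) has_derivative (\<lambda>s. s *\<^sub>R i)) (at 0)"
        by (auto intro!: derivative_eq_intros)
      from has_derivative_compose[OF this, of G D] 1(2)
      have "((\<lambda>t. G (x + t *\<^sub>R i)) has_derivative (\<lambda>s. D (s *\<^sub>R i))) (at 0)" by simp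
      then have "((\<lambda>t. G (x + t *\<^sub>R i) \<bullet> i) has_derivative (\<lambda>s. D (s *\<^sub>R i) \<bullet> i)) (at 0)"
        by (rule has_derivative_inner_left)
      then show ?thesis
        unfolding has_field_derivative_def
        using has_derivative_linear[OF 1(2)] by (simp add: linear_scale mult_commute_abs)
    qed
    from DERIV_neg_dec_right[OF this] neg h0 obtain e where e: "e > 0"
      and dec: "\<And>t. 0 < t \<Longrightarrow> t < e \<Longrightarrow> G (x + t *\<^sub>R i) \<bullet> i < 0" by auto
    define t where "t = min d e / 2"
    have t: "0 < t" "t < d" "t < e" using d e by (auto simp: t_def)
    have "h t < h 0"
    proof (rule DERIV_neg_imp_decreasing_open[OF t(1)])
      fix s assume "0 < s" "s < t"
      then show "\<exists>y. (h has_real_derivative y) (at s) \<and> y < 0"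
        using h'[of s] dec[of s] t by auto
    next
      show "continuous_on {0..t} h"
        by (rule DERIV_continuous_on[where D="\<lambda>s. G (x + s *\<^sub>R i) \<bullet> i"])
          (use h' t in \<open>auto intro: has_field_derivative_at_within\<close>)
    qed
    moreover have "h 0 = f x" by (simp add: h_def)
    ultimately show False using near[of t] t by auto
  qed
  then show ?thesis using 1(4) by (simp add: sum_nonneg)
qed

text \<open>
  The link to the coordinate definitions: differentiability gives the gradient as the vector of
  partial derivatives, and their partial derivatives are the diagonal of the Hessian.
\<close>
lemma Ck_on_2_has_grad_lap:
  fixes f :: "real ^ 'n::finite \<Rightarrow> real"
  assumes "open S" "x \<in> S" "Ck_on 2 f S"
  shows "has_grad_lap f (\<Sum>i\<in>UNIV. partial_deriv i f x *\<^sub>R axis i 1) (laplacian f x) x"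
proof -
  have 1: "f differentiable (at y)" "partial_deriv i f differentiable (at y)" if "y \<in> S" for y i
    using assms that by (auto simp: numeral_2_eq_2)
  let ?D = "\<lambda>i. frechet_derivative (partial_deriv i f) (at x)"
  have B: "(Basis :: (real^'n) set) = (\<lambda>i. axis i 1) ` UNIV" by (auto simp: Basis_vec_def)
  have inj: "inj (\<lambda>i::'n. axis i (1::real))" by (auto simp: inj_def axis_eq_axis)
  show ?thesis
  proof (rule has_grad_lapI)
    have "(f has_derivative (\<lambda>h. (\<Sum>i\<in>UNIV. partial_deriv i f y *\<^sub>R axis i 1) \<bullet> h)) (at y)" if "y \<in> S" for y
    proof -
      let ?F = "frechet_derivative f (at y)"
      have d: "(f has_derivative ?F) (at y)" using 1 that by (simp add: frechet_derivative_works)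
      have "?F = (\<lambda>h. (\<Sum>i\<in>UNIV. partial_deriv i f y *\<^sub>R axis i 1) \<bullet> h)"
      proof
        fix h :: "real ^ 'n"
        have "h = (\<Sum>i\<in>UNIV. h $ i *\<^sub>R axis i 1)"
          by (simp add: vec_eq_iff axis_def if_distrib cong: if_cong)
        then have "?F h = ?F (\<Sum>i\<in>UNIV. h $ i *\<^sub>R axis i 1)" by (rule arg_cong)
        also have "\<dots> = (\<Sum>i\<in>UNIV. h $ i * ?F (axis i 1))"
          by (simp add: linear_sum[OF has_derivative_linear[OF d]] linear_scale[OF has_derivative_linear[OF d]])
        finally show "?F h = (\<Sum>i\<in>UNIV. partial_deriv i f y *\<^sub>R axis i 1) \<bullet> h"
          by (simp add: partial_deriv_def inner_sum_left inner_axis' mult.commute)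
      qed
      with d show ?thesis by (rule subst[rotated])
    qed
    then show "\<forall>\<^sub>F y in nhds x. (f has_derivative
       (\<lambda>h. (\<Sum>i\<in>UNIV. partial_deriv i f y *\<^sub>R axis i 1) \<bullet> h)) (at y)"
      using assms eventually_nhds by blast
    show "((\<lambda>y. \<Sum>i\<in>UNIV. partial_deriv i f y *\<^sub>R axis i 1) has_derivative
       (\<lambda>h. \<Sum>i\<in>UNIV. ?D i h *\<^sub>R axis i 1)) (at x)"
      by (intro has_derivative_sum has_derivative_scaleR_left)
         (use 1 assms in \<open>simp add: frechet_derivative_works\<close>)
    show "laplacian f x = (\<Sum>b\<in>Basis. (\<Sum>i\<in>UNIV. ?D i b *\<^sub>R axis i 1) \<bullet> b)"
      unfolding B sum.reindex[OF inj]
      by (simp add: laplacian_def partial_deriv_def[of _ "partial_deriv _ f"] inner_sum_left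
         inner_axis_axis if_distrib cong: if_cong)
  qed simp
qed

lemma partial_deriv_cong:
  fixes f g :: "real ^ 'n::finite \<Rightarrow> real"
  assumes "open S" "x \<in> S" "\<And>y. y \<in> S \<Longrightarrow> f y = g y"
  shows "partial_deriv i f x = partial_deriv i g x"
proof -
  have "(f has_derivative D) (at x) \<longleftrightarrow> (g has_derivative D) (at x)" for D
    using has_derivative_transform_within_open[OF _ assms(1,2), of f D UNIV g]
      has_derivative_transform_within_open[OF _ assms(1,2), of g D UNIV f] assms(3) by auto
  then show ?thesis by (simp add: partial_deriv_def frechet_derivative_def)
qed

lemma laplacian_cong:
  fixes f g :: "real ^ 'n::finite \<Rightarrow> real"
  assumes "open S" "x \<in> S" "\<And>y. y \<in> S \<Longrightarrow> f y = g y"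
  shows "laplacian f x = laplacian g x"
  unfolding laplacian_def
  using assms by (intro sum.cong refl partial_deriv_cong[of S]) (auto intro: partial_deriv_cong)

section \<open>Minimum principles\<close>

text \<open>
  All minimum principles below have this form. If \<open>w\<close> were negative somewhere, then for
  the least \<open>\<theta>\<close> that makes \<open>w + \<theta> \<phi>\<close> nonnegative this sum would have a zero, at a point where \<open>w\<close>
  is negative; the hypothesis \<open>touch\<close> excludes this. Dividing by \<open>\<phi>\<close>
  (that is, not restricting to \<open>\<phi> = 1\<close>) makes it possible to absorb a zeroth order term of the
  wrong sign in a boundary condition.
\<close>
lemma minimum_comparison:
  fixes w \<phi> :: "'a::euclidean_space \<Rightarrow> real"
  assumes E: "compact E" and cont: "continuous_on E w" "continuous_on E \<phi>"
    and pos: "\<And>x. x \<in> E \<Longrightarrow> 0 < \<phi> x"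
    and touch: "\<And>x \<theta>. x \<in> E \<Longrightarrow> w x < 0 \<Longrightarrow> 0 < \<theta> \<Longrightarrow> w x + \<theta> * \<phi> x = 0 \<Longrightarrow>
        (\<And>y. y \<in> E \<Longrightarrow> 0 \<le> w y + \<theta> * \<phi> y) \<Longrightarrow> False"
    and x: "x \<in> E"
  shows "0 \<le> w x"
proof -
  have "continuous_on E (\<lambda>x. w x / \<phi> x)"
    using pos by (intro continuous_on_divide cont) fastforce
  then obtain z where z: "z \<in> E" "\<And>y. y \<in> E \<Longrightarrow> w z / \<phi> z \<le> w y / \<phi> y"
    using continuous_attains_inf[OF E] x by blast
  have "0 \<le> w z / \<phi> z"
  proof (rule ccontr)
    assume n: "\<not> ?thesis"
    let ?\<theta> = "- (w z / \<phi> z)"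
    show False
    proof (rule touch[OF z(1), of ?\<theta>])
      show "w z < 0" using n pos[OF z(1)] by (simp add: not_le divide_less_0_iff)
      show "0 < ?\<theta>" using n by simp
      show "w z + ?\<theta> * \<phi> z = 0" using pos[OF z(1)] by simp
      show "0 \<le> w y + ?\<theta> * \<phi> y" if "y \<in> E" for y
        using z(2)[OF that] pos[OF that] by (simp add: pos_le_divide_eq)
    qed
  qed
  then have "0 \<le> w x / \<phi> x" using z(2)[OF x] by linarith
  then show ?thesis using pos[OF x] by (simp add: zero_le_divide_iff)
qed

text \<open>
  The first order condition at a boundary minimum of a function on the ball.
\<close>
lemma radial_derivative_nonpos:
  fixes f :: "'a::real_normed_vector \<Rightarrow> real"
  assumes f: "(f has_derivative f') (at x)" and min: "\<forall>\<^sub>F t in at_left 1. f x \<le> f (t *\<^sub>R x)"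
  shows "f' x \<le> 0"
proof (rule ccontr)
  assume pos: "\<not> ?thesis"
  have "((\<lambda>t. t *\<^sub>R x) has_derivative (\<lambda>s. s *\<^sub>R x)) (at 1)"
    by (auto intro!: derivative_eq_intros)
  from has_derivative_compose[OF this, of f f'] f
  have "((\<lambda>t. f (t *\<^sub>R x)) has_derivative (\<lambda>s. f' (s *\<^sub>R x))) (at 1)" by simp
  then have "((\<lambda>t. f (t *\<^sub>R x)) has_real_derivative f' x) (at 1)"
    unfolding has_field_derivative_def
    using has_derivative_linear[OF f] by (simp add: linear_scale mult_commute_abs)
  from DERIV_pos_inc_left[OF this] pos obtain d where d: "d > 0"
    "\<And>h. 0 < h \<Longrightarrow> h < d \<Longrightarrow> f ((1 - h) *\<^sub>R x) < f x" by auto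
  obtain b where b: "b < 1" "\<And>t. b < t \<Longrightarrow> t < 1 \<Longrightarrow> f x \<le> f (t *\<^sub>R x)"
    using min by (auto simp: eventually_at_left_field)
  define h where "h = min d (1 - b) / 2"
  have "0 < h" "h < d" "h < 1 - b" using d b by (auto simp: h_def)
  then show False using d(2)[of h] b(2)[of "1 - h"] by auto
qed

lemma eventually_radial_in_ball:
  fixes x :: "'a::real_normed_vector"
  assumes x: "norm x = 1" and S: "open S" "x \<in> S"
  shows "\<forall>\<^sub>F t in at_left 1. norm (t *\<^sub>R x) < 1 \<and> t *\<^sub>R x \<in> S"
proof -
  have "((\<lambda>t. t *\<^sub>R x) \<longlongrightarrow> 1 *\<^sub>R x) (at_left 1)" by (intro tendsto_intros)
  then have "\<forall>\<^sub>F t in at_left 1. t *\<^sub>R x \<in> S" using topological_tendstoD[of "\<lambda>t. t *\<^sub>R x" "1 *\<^sub>R x"] S by simp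
  moreover have "\<forall>\<^sub>F t::real in at_left 1. 0 < t \<and> t < 1"
    by (auto simp: eventually_at_left_field intro!: exI[of _ 0])
  ultimately show ?thesis by eventually_elim (use x in auto)
qed

text \<open>
  The weak minimum principle on the unit ball, with the strictly superharmonic comparison function
  \<open>2 - \<bar>x\<bar>\<^sup>2\<close>.
\<close>
lemma harmonic_nonneg_from_boundary:
  fixes w :: "'a::euclidean_space \<Rightarrow> real"
  assumes cont: "continuous_on (cball 0 1) w" and harm: "\<And>x. norm x < 1 \<Longrightarrow> \<exists>g. has_grad_lap w g 0 x"
    and bd: "\<And>x. norm x = 1 \<Longrightarrow> 0 \<le> w x" and x: "norm x \<le> 1"
  shows "0 \<le> w x"
proof (rule minimum_comparison[of "cball 0 1" w "\<lambda>x. 2 - (x - 0) \<bullet> (x - 0)"])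
  show "continuous_on (cball 0 1) (\<lambda>x::'a. 2 - (x - 0) \<bullet> (x - 0))" by (intro continuous_intros)
  show "0 < 2 - (x - 0) \<bullet> (x - 0)" if "x \<in> cball 0 1" for x :: 'a
    using that power_le_one[of "norm x" 2] by (simp add: dot_square_norm)
next
  fix x \<theta>
  assume x: "x \<in> cball 0 1" and neg: "w x < 0" and \<theta>: "0 < \<theta>" and eq: "w x + \<theta> * (2 - (x - 0) \<bullet> (x - 0)) = 0"
    and min: "\<And>y. y \<in> cball 0 1 \<Longrightarrow> 0 \<le> w y + \<theta> * (2 - (y - 0) \<bullet> (y - 0))"
  have nx: "norm x < 1" using x bd[of x] neg by (cases "norm x = 1") auto
  obtain g where "has_grad_lap w g 0 x" using harm nx by blast
  then have sum: "has_grad_lap (\<lambda>x. w x + \<theta> * (2 - (x - 0) \<bullet> (x - 0))) (g + \<theta> *\<^sub>R (0 - 2 *\<^sub>R (x - 0)))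
     (0 + \<theta> * (0 - 2 * real DIM('a))) x"
    by (intro has_grad_lap_add has_grad_lap_cmult has_grad_lap_diff has_grad_lap_const has_grad_lap_norm_sq)
  have "\<forall>\<^sub>F y in nhds x. y \<in> ball 0 1" using nx by (intro eventually_nhds_in_open) auto
  then have "\<forall>\<^sub>F y in nhds x. w x + \<theta> * (2 - (x - 0) \<bullet> (x - 0)) \<le> w y + \<theta> * (2 - (y - 0) \<bullet> (y - 0))"
    unfolding eq by eventually_elim (intro min, auto)
  from has_grad_lap_local_min[OF sum this] show False using \<theta> by (simp add: mult_le_0_iff)
qed (use cont x in auto)

text \<open>
  Positivity at the centre propagates to the whole ball: on the annulus between a small sphere where
  \<open>w\<close> is still positive and the outer sphere, \<open>w\<close> lies above a small multiple of the subharmonic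
  function \<open>exp (- k \<bar>x - y\<bar>\<^sup>2) - exp (- k R\<^sup>2)\<close>, which vanishes only on the outer sphere.
\<close>
lemma harmonic_nonneg_pos_on_ball:
  fixes w :: "'a::euclidean_space \<Rightarrow> real"
  assumes cont: "continuous_on (cball y R) w" and nonneg: "\<And>x. x \<in> cball y R \<Longrightarrow> 0 \<le> w x"
    and harm: "\<And>x. x \<in> ball y R \<Longrightarrow> \<exists>g. has_grad_lap w g 0 x"
    and y: "0 < w y" and x: "x \<in> ball y R"
  shows "0 < w x"
proof -
  have R: "0 < R" using x by (metis ball_eq_empty empty_iff not_le)
  have "isCont w y" using cont R
    by (metis (no_types, lifting) centre_in_ball continuous_on_interior interior_cball)
  then have "\<forall>\<^sub>F x in nhds y. w y / 2 < w x"
    using y by (intro order_tendstoD[where y="w y"])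
      (auto simp: isCont_def tendsto_at_iff_tendsto_nhds)
  then obtain d where d: "d > 0" "\<And>x. dist x y < d \<Longrightarrow> w y / 2 < w x"
    by (auto simp: eventually_nhds_metric)
  define r where "r = min d R / 2"
  have r: "0 < r" "r < d" "r < R" using d R by (auto simp: r_def)
  \<comment> \<open>Any \<open>k > n / (2 r\<^sup>2)\<close> makes \<open>exp (- k \<bar>x - y\<bar>\<^sup>2)\<close> strictly subharmonic where \<open>\<bar>x - y\<bar> \<ge> r\<close>.\<close>
  define k where "k = DIM('a) / (2 * r\<^sup>2) + 1"
  have k: "k > 0" "DIM('a) < 2 * k * r\<^sup>2" using r by (auto simp: k_def field_simps intro: add_pos_nonneg)
  define N where "N = (\<lambda>x. (x - y) \<bullet> (x - y))"
  have N: "N z = (dist y z)\<^sup>2" for z by (simp add: N_def dist_norm dot_square_norm norm_minus_commute)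
  define \<epsilon> where "\<epsilon> = w y / 2"
  define A where "A = cball y R - ball y r"
  have \<psi>: "exp (- k * N z) - exp (- k * R\<^sup>2) \<le> 1" for z
    using k(1) by (smt (verit) N exp_gt_zero exp_le_one_iff mult_nonneg_nonneg zero_le_power2 mult_minus_left)
  have main: "0 \<le> w z + - \<epsilon> * (exp (- k * N z) - exp (- k * R\<^sup>2))" if "z \<in> A" for z
  proof (rule minimum_comparison[where \<phi>="\<lambda>_. 1" and E=A, OF _ _ _ _ _ that])
    show "compact A" unfolding A_def by (intro compact_diff compact_cball open_ball)
    show "continuous_on A (\<lambda>z. w z + - \<epsilon> * (exp (- k * N z) - exp (- k * R\<^sup>2)))"
      unfolding N_def A_def by (intro continuous_intros continuous_on_subset[OF cont]) auto
  next
    fix z \<theta>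
    assume z: "z \<in> A" and neg: "w z + - \<epsilon> * (exp (- k * N z) - exp (- k * R\<^sup>2)) < 0"
      and eq: "w z + - \<epsilon> * (exp (- k * N z) - exp (- k * R\<^sup>2)) + \<theta> * 1 = 0"
      and min: "\<And>x. x \<in> A \<Longrightarrow> 0 \<le> w x + - \<epsilon> * (exp (- k * N x) - exp (- k * R\<^sup>2)) + \<theta> * 1"
    have "dist y z \<noteq> R" using neg nonneg[of z] z by (auto simp: N A_def)
    moreover have "dist y z \<noteq> r"
    proof
      assume "dist y z = r"
      then have "\<epsilon> < w z" using d(2)[of z] r by (simp add: dist_commute \<epsilon>_def)
      moreover have "\<epsilon> * (exp (- k * N z) - exp (- k * R\<^sup>2)) \<le> \<epsilon> * 1"
        using \<psi>[of z] y by (intro mult_left_mono) (auto simp: \<epsilon>_def)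
      ultimately show False using neg by simp
    qed
    ultimately have rz: "r < dist y z" "dist y z < R" using z by (auto simp: A_def)
    obtain g1 where g1: "has_grad_lap w g1 0 z" using harm rz by auto
    obtain g2 where "has_grad_lap (\<lambda>x. exp (- k * N x)) g2
       (exp (- k * N z) * (4 * k\<^sup>2 * N z - 2 * k * DIM('a))) z"
      using has_grad_lap_exp_norm_sq[of "- k" y 0 z] unfolding N_def by (simp add: algebra_simps)
    from has_grad_lap_add[OF g1 has_grad_lap_cmult[OF
        has_grad_lap_diff[OF this has_grad_lap_const[of "exp (- k * R\<^sup>2)"]], of "- \<epsilon>"]]
    have lap: "has_grad_lap (\<lambda>x. w x + - \<epsilon> * (exp (- k * N x) - exp (- k * R\<^sup>2)))
       (g1 + - \<epsilon> *\<^sub>R (g2 - 0)) (- \<epsilon> * (exp (- k * N z) * (4 * k\<^sup>2 * N z - 2 * k * DIM('a)))) z"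
      by simp
    have "open (ball y R - cball y r)" "z \<in> ball y R - cball y r" using rz by auto
    moreover have "ball y R - cball y r \<subseteq> A" by (auto simp: A_def)
    ultimately have "\<forall>\<^sub>F x in nhds z. x \<in> A"
      by (meson eventually_nhds subsetD)
    then have "\<forall>\<^sub>F x in nhds z. w z + - \<epsilon> * (exp (- k * N z) - exp (- k * R\<^sup>2)) \<le>
        w x + - \<epsilon> * (exp (- k * N x) - exp (- k * R\<^sup>2))"
      by eventually_elim (use min eq in fastforce)
    from has_grad_lap_local_min[OF lap this]
    have "\<epsilon> * (exp (- k * N z) * (4 * k\<^sup>2 * N z - 2 * k * DIM('a))) \<le> 0" by simp
    moreover have "r\<^sup>2 < N z" unfolding N using rz r by (intro power_strict_mono) auto
    then have "2 * k * r\<^sup>2 < 2 * k * N z" using k by simp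
    then have "0 < 2 * k * (2 * k * N z - DIM('a))" using k by (intro mult_pos_pos) linarith+
    then have "0 < 4 * k\<^sup>2 * N z - 2 * k * DIM('a)" by (simp add: algebra_simps power2_eq_square)
    ultimately show False using y by (simp add: \<epsilon>_def mult_le_0_iff)
  qed auto
  show ?thesis
  proof (cases "x \<in> ball y r")
    case True
    then show ?thesis using d(2)[of x] r y by (auto simp: dist_commute)
  next
    case False
    then have "0 \<le> w x + - \<epsilon> * (exp (- k * N x) - exp (- k * R\<^sup>2))"
      using x by (intro main) (auto simp: A_def)
    moreover have "N x < R\<^sup>2" unfolding N using x by (intro power_strict_mono) auto
    then have "0 < \<epsilon> * (exp (- k * N x) - exp (- k * R\<^sup>2))"
      using k y by (intro mult_pos_pos) (auto simp: \<epsilon>_def)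
    ultimately show ?thesis by simp
  qed
qed

text \<open>
  The strong minimum principle. The zero set is open, because a point of positivity close to a zero
  would be the centre of a ball containing that zero.
\<close>
lemma harmonic_nonneg_strong_min:
  fixes w :: "'a::euclidean_space \<Rightarrow> real"
  assumes D: "open D" "connected D" and nonneg: "\<And>x. x \<in> D \<Longrightarrow> 0 \<le> w x"
    and harm: "\<And>x. x \<in> D \<Longrightarrow> \<exists>g. has_grad_lap w g 0 x"
    and z: "z \<in> D" "w z = 0" and x: "x \<in> D"
  shows "w x = 0"
proof -
  have cont: "isCont w x" if "x \<in> D" for x
    using harm[OF that] has_grad_lap_imp_has_derivative has_derivative_continuous by blast
  let ?P = "{x \<in> D. 0 < w x}" and ?Z = "{x \<in> D. w x = 0}"
  have conD: "continuous_on D w" using cont by (simp add: continuous_at_imp_continuous_on)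
  have "open ?Z"
    unfolding open_contains_ball
  proof
    fix a assume a: "a \<in> ?Z"
    then obtain e where e: "e > 0" "ball a e \<subseteq> D" using D open_contains_ball by blast
    have "w b = 0" if b: "b \<in> ball a (e / 3)" for b
    proof (rule ccontr)
      assume "w b \<noteq> 0"
      have sub: "cball b (e / 2) \<subseteq> ball a e"
      proof
        fix t assume "t \<in> cball b (e / 2)"
        then show "t \<in> ball a e" using b e dist_triangle[of a t b] by auto
      qed
      then have sub: "cball b (e / 2) \<subseteq> D" using e by blast
      have "b \<in> D" using sub e by auto
      then have "0 < w b" using nonneg[of b] \<open>w b \<noteq> 0\<close> by fastforce
      have "0 < w a"
      proof (rule harmonic_nonneg_pos_on_ball[of b "e / 2"])
        show "continuous_on (cball b (e / 2)) w" by (rule continuous_on_subset[OF conD sub])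
        show "0 \<le> w t" if "t \<in> cball b (e / 2)" for t using nonneg sub that by blast
        show "\<exists>g. has_grad_lap w g 0 t" if "t \<in> ball b (e / 2)" for t
          using harm sub that ball_subset_cball by blast
      qed (use b e \<open>0 < w b\<close> in \<open>auto simp: dist_commute\<close>)
      then show False using a by simp
    qed
    moreover have "ball a (e / 3) \<subseteq> ball a e" using e by (intro subset_ball) simp
    ultimately show "\<exists>e>0. ball a e \<subseteq> ?Z" using e by (intro exI[of _ "e / 3"]) auto
  qed
  moreover have "open ?P"
    using continuous_open_preimage[OF conD D(1), of "{0<..}"] by (simp add: vimage_def Int_def)
  moreover have "D \<subseteq> ?P \<union> ?Z" using nonneg by fastforce
  moreover have "?P \<inter> ?Z \<inter> D = {}" by auto
  ultimately have "?P \<inter> D = {} \<or> ?Z \<inter> D = {}"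
    using connectedD[OF D(2)] by blast
  then have "?P = {}" using z by auto
  then show ?thesis using nonneg[OF x] x by fastforce
qed

section \<open>Inversions and the Kelvin transform\<close>

lemma sum_Basis_linear:
  fixes l :: "'a::euclidean_space \<Rightarrow> real"
  assumes "linear l"
  shows "(\<Sum>i\<in>Basis. l i * (z \<bullet> i)) = l z"
proof -
  have "l z = l (\<Sum>i\<in>Basis. (z \<bullet> i) *\<^sub>R i)" by (simp add: euclidean_representation)
  also have "\<dots> = (\<Sum>i\<in>Basis. l i * (z \<bullet> i))"
    by (simp add: linear_sum[OF assms] linear_scale[OF assms] mult.commute)
  finally show ?thesis ..
qed

text \<open>
  Inversion in the sphere with centre \<open>c\<close> and squared radius \<open>\<rho>\<close>.
\<close>
definition inversion :: "'a::euclidean_space \<Rightarrow> real \<Rightarrow> 'a \<Rightarrow> 'a" where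
  "inversion c \<rho> x = c + (\<rho> / ((x - c) \<bullet> (x - c))) *\<^sub>R (x - c)"

lemma has_derivative_norm_sq:
  fixes c y :: "'a::euclidean_space"
  shows "((\<lambda>y. (y - c) \<bullet> (y - c)) has_derivative (\<lambda>h. 2 * ((y - c) \<bullet> h))) (at y)"
  using has_grad_lap_imp_has_derivative[OF has_grad_lap_norm_sq] by simp

lemma has_derivative_divide_norm_sq:
  fixes c y :: "'a::euclidean_space"
  assumes "y \<noteq> c" "(f has_derivative f') (at y)"
  defines "N \<equiv> (y - c) \<bullet> (y - c)"
  shows "((\<lambda>y. f y / ((y - c) \<bullet> (y - c))) has_derivative
           (\<lambda>h. f' h / N - 2 * f y * ((y - c) \<bullet> h) / N\<^sup>2)) (at y)"
proof -
  have N: "N \<noteq> 0" using assms by simp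
  have "(\<lambda>h. (f' h * N - f y * (2 * ((y - c) \<bullet> h))) / (N * N)) =
        (\<lambda>h. f' h / N - 2 * f y * ((y - c) \<bullet> h) / N\<^sup>2)"
    using N by (simp add: fun_eq_iff diff_divide_distrib power2_eq_square)
  with has_derivative_divide'[OF assms(2) has_derivative_norm_sq[of c y] N[unfolded N_def]]
  show ?thesis unfolding N_def by simp
qed

lemma inversion_has_derivative:
  fixes c y :: "'a::euclidean_space"
  assumes "y \<noteq> c"
  defines "N \<equiv> (y - c) \<bullet> (y - c)"
  shows "(inversion c \<rho> has_derivative
     (\<lambda>h. (\<rho> / N) *\<^sub>R (h - (2 * ((y - c) \<bullet> h) / N) *\<^sub>R (y - c)))) (at y)"
proof -
  have "((\<lambda>y. c + (\<rho> / ((y - c) \<bullet> (y - c))) *\<^sub>R (y - c)) has_derivative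
     (\<lambda>h. 0 + ((\<rho> / N) *\<^sub>R (h - 0) + (0 / N - 2 * \<rho> * ((y - c) \<bullet> h) / N\<^sup>2) *\<^sub>R (y - c)))) (at y)"
    unfolding N_def
    by (intro has_derivative_add has_derivative_scaleR has_derivative_diff has_derivative_ident
        has_derivative_const has_derivative_divide_norm_sq assms)
  also have "(\<lambda>h. 0 + ((\<rho> / N) *\<^sub>R (h - 0) + (0 / N - 2 * \<rho> * ((y - c) \<bullet> h) / N\<^sup>2) *\<^sub>R (y - c)))
     = (\<lambda>h. (\<rho> / N) *\<^sub>R (h - (2 * ((y - c) \<bullet> h) / N) *\<^sub>R (y - c)))"
    (is "?l = ?r")
  proof
    fix h
    have "0 / N - 2 * \<rho> * ((y - c) \<bullet> h) / N\<^sup>2 = - ((\<rho> / N) * (2 * ((y - c) \<bullet> h) / N))"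
      by (simp add: power2_eq_square)
    then show "?l h = ?r h"
      by (simp only: scaleR_minus_left scaleR_diff_right[of "\<rho> / N"] scaleR_scaleR) simp
  qed
  finally show ?thesis unfolding inversion_def[abs_def] .
qed

text \<open>
  An inversion is conformal: its derivative is \<open>\<rho> / N\<close> times a reflection. Hence composing with it
  multiplies the Laplacian by \<open>(\<rho> / N)\<^sup>2\<close>, up to the first order term caused by the variation of the
  conformal factor.
\<close>
lemma has_grad_lap_compose_inversion:
  fixes c x :: "'a::euclidean_space"
  assumes xc: "x \<noteq> c" and U: "has_grad_lap U g L (inversion c \<rho> x)"
  defines "z \<equiv> x - c" and "N \<equiv> (x - c) \<bullet> (x - c)"
  shows "has_grad_lap (\<lambda>x. U (inversion c \<rho> x)) ((\<rho> / N) *\<^sub>R (g - (2 * (z \<bullet> g) / N) *\<^sub>R z))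
     ((4 - 2 * real DIM('a)) * (\<rho> / N\<^sup>2) * (z \<bullet> g) + (\<rho> / N)\<^sup>2 * L) x"
proof -
  obtain G D where 1: "\<forall>\<^sub>F y in nhds (inversion c \<rho> x). (U has_derivative (\<lambda>h. G y \<bullet> h)) (at y)"
    "(G has_derivative D) (at (inversion c \<rho> x))" "G (inversion c \<rho> x) = g" "L = (\<Sum>i\<in>Basis. D i \<bullet> i)"
    using U unfolding has_grad_lap_def by blast
  define \<sigma> where "\<sigma> = inversion c \<rho>"
  define S where "S = (\<lambda>h. (\<rho> / N) *\<^sub>R (h - (2 * (z \<bullet> h) / N) *\<^sub>R z))"
  have N: "N \<noteq> 0" using xc by (simp add: N_def)
  have \<sigma>': "(\<sigma> has_derivative S) (at x)"
    using inversion_has_derivative[OF xc] by (simp add: \<sigma>_def S_def z_def N_def)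
  have linS: "linear S" and linD: "linear D"
    using \<sigma>' 1(2) has_derivative_linear by blast+
  have "(\<sigma> \<longlongrightarrow> \<sigma> x) (nhds x)"
    using has_derivative_continuous[OF \<sigma>'] by (simp add: isCont_def tendsto_at_iff_tendsto_nhds)
  then have ev: "\<forall>\<^sub>F y in nhds x. (U has_derivative (\<lambda>h. G (\<sigma> y) \<bullet> h)) (at (\<sigma> y))"
    using eventually_compose_filterlim[OF 1(1)] by (simp add: \<sigma>_def)
  have ne: "\<forall>\<^sub>F y in nhds x. y \<noteq> c" using xc t1_space_nhds by blast
  let ?q = "\<lambda>y. 2 * ((y - c) \<bullet> G (\<sigma> y)) / ((y - c) \<bullet> (y - c))"
  let ?\<psi> = "\<lambda>y. \<rho> / ((y - c) \<bullet> (y - c))"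
  define q' where "q' = (\<lambda>h. 2 * (z \<bullet> D (S h) + h \<bullet> g) / N - 2 * (2 * (z \<bullet> g)) * (z \<bullet> h) / N\<^sup>2)"
  define \<psi>' where "\<psi>' = (\<lambda>h. 0 / N - 2 * \<rho> * (z \<bullet> h) / N\<^sup>2)"
  define q where "q = 2 * (z \<bullet> g) / N"
  have G\<sigma>: "((\<lambda>y. G (\<sigma> y)) has_derivative (\<lambda>h. D (S h))) (at x)"
    using has_derivative_compose[OF \<sigma>' 1(2)[folded \<sigma>_def]] .
  have gx: "G (\<sigma> x) = g" using 1 by (simp add: \<sigma>_def)
  have "((\<lambda>y. 2 * ((y - c) \<bullet> G (\<sigma> y))) has_derivative (\<lambda>h. 2 * ((x - c) \<bullet> D (S h) + (h - 0) \<bullet> G (\<sigma> x)))) (at x)"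
    by (intro has_derivative_mult_right has_derivative_inner has_derivative_diff has_derivative_ident
        has_derivative_const G\<sigma>)
  from has_derivative_divide_norm_sq[OF xc this]
  have q: "(?q has_derivative q') (at x)"
    by (simp add: q'_def gx z_def N_def)
  have \<psi>: "(?\<psi> has_derivative \<psi>') (at x)"
    unfolding \<psi>'_def N_def z_def by (intro has_derivative_divide_norm_sq xc has_derivative_const)
  show ?thesis
  proof (rule has_grad_lapI[where G="\<lambda>y. ?\<psi> y *\<^sub>R (G (\<sigma> y) - ?q y *\<^sub>R (y - c))"])
    show "\<forall>\<^sub>F y in nhds x. ((\<lambda>x. U (inversion c \<rho> x)) has_derivative
        (\<lambda>h. (?\<psi> y *\<^sub>R (G (\<sigma> y) - ?q y *\<^sub>R (y - c))) \<bullet> h)) (at y)"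
      using ev ne
    proof eventually_elim
      case (elim y)
      have adj: "v \<bullet> (r *\<^sub>R (h - (2 * (e \<bullet> h) / M) *\<^sub>R e)) = (r *\<^sub>R (v - (2 * (e \<bullet> v) / M) *\<^sub>R e)) \<bullet> h"
        for v h e :: 'a and r M by (simp add: inner_diff_left inner_diff_right inner_commute)
      show ?case
        using has_derivative_compose[OF inversion_has_derivative[OF elim(2), of \<rho>] elim(1)[unfolded \<sigma>_def]]
        unfolding \<sigma>_def adj .
    qed
    show "((\<lambda>y. ?\<psi> y *\<^sub>R (G (\<sigma> y) - ?q y *\<^sub>R (y - c))) has_derivative
       (\<lambda>h. ?\<psi> x *\<^sub>R (D (S h) - (?q x *\<^sub>R (h - 0) + q' h *\<^sub>R (x - c))) + \<psi>' h *\<^sub>R (G (\<sigma> x) - ?q x *\<^sub>R (x - c)))) (at x)"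
      by (intro has_derivative_scaleR has_derivative_diff \<psi> q G\<sigma> has_derivative_ident has_derivative_const)
    show "?\<psi> x *\<^sub>R (G (\<sigma> x) - ?q x *\<^sub>R (x - c)) = (\<rho> / N) *\<^sub>R (g - (2 * (z \<bullet> g) / N) *\<^sub>R z)"
      by (simp add: gx z_def N_def)
    have lq: "linear q'" and l\<psi>: "linear \<psi>'" using q \<psi> has_derivative_linear by blast+
    \<comment> \<open>\<open>S\<close> is \<open>\<rho> / N\<close> times a reflection, so tracing \<open>D \<circ> S\<close> over a basis yields the Laplacian
        up to a term in the direction \<open>z\<close>, which cancels against the derivative of \<open>q\<close>.\<close>
    have DS: "(\<Sum>i\<in>Basis. D (S i) \<bullet> i) = (\<rho> / N) * (L - (2 / N) * (D z \<bullet> z))"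
    proof -
      have "D (S i) \<bullet> i = (\<rho> / N) * (D i \<bullet> i - (2 / N) * ((D z \<bullet> i) * (z \<bullet> i)))" for i
        unfolding S_def by (simp add: linear_scale[OF linD] linear_diff[OF linD] inner_diff_left)
      then show ?thesis
        unfolding 1(4) euclidean_inner[of "D z" z]
        by (simp only: sum_distrib_left[symmetric] sum_subtractf)
    qed
    have zz: "z \<bullet> z = N" by (simp add: z_def N_def)
    have Sz: "S z = (- (\<rho> / N)) *\<^sub>R z"
      using N by (simp add: S_def zz scaleR_2)
    have q'z: "q' z = 2 * (z \<bullet> g - (\<rho> / N) * (D z \<bullet> z)) / N - 4 * (z \<bullet> g) / N"
      using N by (simp add: q'_def Sz linear_scale[OF linD] zz inner_commute power2_eq_square linear_neg[OF linD])
    have "(\<Sum>i\<in>Basis. (?\<psi> x *\<^sub>R (D (S i) - (?q x *\<^sub>R (i - 0) + q' i *\<^sub>R (x - c)))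
            + \<psi>' i *\<^sub>R (G (\<sigma> x) - ?q x *\<^sub>R (x - c))) \<bullet> i)
        = (\<Sum>i\<in>Basis. (\<rho> / N) * (D (S i) \<bullet> i) - (\<rho> / N) * q * (i \<bullet> i) - (\<rho> / N) * (q' i * (z \<bullet> i))
            + \<psi>' i * (g \<bullet> i) - q * (\<psi>' i * (z \<bullet> i)))"
      unfolding gx z_def[symmetric] zz q_def[symmetric] by (intro sum.cong refl)
        (simp add: inner_add_left inner_diff_left algebra_simps)
    also have "\<dots> = (\<rho> / N) * ((\<rho> / N) * (L - (2 / N) * (D z \<bullet> z))) - (\<rho> / N) * q * DIM('a)
         - (\<rho> / N) * q' z + \<psi>' g - q * \<psi>' z"
      unfolding sum_subtractf sum.distrib sum_distrib_left[symmetric] DS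
        sum_Basis_linear[OF lq] sum_Basis_linear[OF l\<psi>] sum_Basis_inner_self ..
    also have "\<dots> = (4 - 2 * real DIM('a)) * (\<rho> / N\<^sup>2) * (z \<bullet> g) + (\<rho> / N)\<^sup>2 * L"
      using N unfolding q'z q_def \<psi>'_def zz by (simp add: field_simps power2_eq_square)
    finally show "(4 - 2 * real DIM('a)) * (\<rho> / N\<^sup>2) * (z \<bullet> g) + (\<rho> / N)\<^sup>2 * L =
       (\<Sum>i\<in>Basis. (?\<psi> x *\<^sub>R (D (S i) - (?q x *\<^sub>R (i - 0) + q' i *\<^sub>R (x - c)))
            + \<psi>' i *\<^sub>R (G (\<sigma> x) - ?q x *\<^sub>R (x - c))) \<bullet> i)" ..
  qed
qed

text \<open>
  The Kelvin transform. The weight \<open>(\<rho> / N) powr m\<close> is harmonic for \<open>m = (n - 2) / 2\<close>, and its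
  gradient then cancels the first order term of \<open>has_grad_lap_compose_inversion\<close>.
\<close>
lemma has_grad_lap_kelvin:
  fixes c x :: "'a::euclidean_space"
  assumes xc: "x \<noteq> c" and \<rho>: "0 < \<rho>" and U: "has_grad_lap U g L (inversion c \<rho> x)"
    and m: "m = (real DIM('a) - 2) / 2"
  defines "z \<equiv> x - c" and "N \<equiv> (x - c) \<bullet> (x - c)"
  shows "has_grad_lap (\<lambda>x. (\<rho> / ((x - c) \<bullet> (x - c))) powr m * U (inversion c \<rho> x))
     ((\<rho> / N) powr m *\<^sub>R ((\<rho> / N) *\<^sub>R (g - (2 * (z \<bullet> g) / N) *\<^sub>R z) - (2 * m * U (inversion c \<rho> x) / N) *\<^sub>R z))
     ((\<rho> / N) powr m * (\<rho> / N)\<^sup>2 * L) x"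
proof -
  have N: "0 < N" "N \<noteq> 0" using xc by (simp_all add: N_def)
  have n: "real DIM('a) = 2 * m + 2" using m by simp
  let ?F = "\<lambda>t. (\<rho> / t) powr m"
  have d0: "(?F has_real_derivative - m * ?F t / t) (at t)" if "t > 0" for t
    using that \<rho> by (auto intro!: derivative_eq_intros simp: field_simps power2_eq_square powr_diff)
  have d1: "((\<lambda>t. - m * ?F t / t) has_real_derivative m * (m + 1) * ?F N / N\<^sup>2) (at N)"
  proof -
    have "((\<lambda>t. - m * ?F t / t) has_real_derivative
        ((- m * (- m * ?F N / N)) * N - (- m * ?F N) * 1) / (N * N)) (at N)"
      by (intro DERIV_divide DERIV_cmult d0 DERIV_ident N)
    then show ?thesis using N by (simp add: field_simps power2_eq_square)
  qed
  have evp: "\<forall>\<^sub>F t in nhds N. 0 < t" using N by (simp add: eventually_nhds) (metis greaterThan_iff open_greaterThan)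
  have evd: "\<forall>\<^sub>F t in nhds ((x - c) \<bullet> (x - c)). (?F has_real_derivative - m * ?F t / t) (at t)"
    using evp unfolding N_def by eventually_elim (rule d0)
  have "has_grad_lap (\<lambda>x. ?F ((x - c) \<bullet> (x - c))) ((- m * ?F N / N) *\<^sub>R (2 *\<^sub>R z))
    ((- m * ?F N / N) * (2 * real DIM('a)) + (m * (m + 1) * ?F N / N\<^sup>2) * ((2 *\<^sub>R z) \<bullet> (2 *\<^sub>R z))) x"
    unfolding z_def N_def
    by (rule has_grad_lap_compose[OF has_grad_lap_norm_sq evd d1[unfolded N_def]])
  moreover have "(- m * ?F N / N) * (2 * real DIM('a)) + (m * (m + 1) * ?F N / N\<^sup>2) * ((2 *\<^sub>R z) \<bullet> (2 *\<^sub>R z)) = 0"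
  proof -
    have "(2 *\<^sub>R z) \<bullet> (2 *\<^sub>R z) = 4 * N" by (simp add: N_def z_def)
    then show ?thesis unfolding n using N by (simp add: field_simps power2_eq_square)
  qed
  ultimately have g: "has_grad_lap (\<lambda>x. ?F ((x - c) \<bullet> (x - c))) ((- m * ?F N / N) *\<^sub>R (2 *\<^sub>R z)) 0 x" by simp
  have zz: "z \<bullet> z = N" by (simp add: z_def N_def)
  have "\<exists>g L. has_grad_lap (\<lambda>x. ?F ((x - c) \<bullet> (x - c)) * U (inversion c \<rho> x)) g L x
      \<and> g = ?F N *\<^sub>R ((\<rho> / N) *\<^sub>R (U' - (2 * (z \<bullet> U') / N) *\<^sub>R z) - (2 * m * U (inversion c \<rho> x) / N) *\<^sub>R z)
      \<and> L = ?F N * (\<rho> / N)\<^sup>2 * L'" if "has_grad_lap U U' L' (inversion c \<rho> x)" for U' L'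
  proof (intro exI conjI, rule has_grad_lap_mult[OF g has_grad_lap_compose_inversion[OF xc that]],
      fold z_def N_def, goal_cases)
    case 1
    then show ?case by (simp add: algebra_simps)
  next
    case 2
    have i: "z \<bullet> (U' - (2 * (z \<bullet> U') / N) *\<^sub>R z) = - (z \<bullet> U')"
      using N by (simp add: inner_diff_right zz)
    show ?case unfolding inner_scaleR_left inner_scaleR_right i
      unfolding n using N by (simp add: field_simps power2_eq_square)
  qed
  from this[OF U] show ?thesis unfolding z_def N_def by blast
qed

section \<open>Inversions preserving the unit ball\<close>

text \<open>
  For \<open>\<bar>p\<bar> = 1\<close> and \<open>0 < \<kappa> < 1\<close> the zero set of \<open>gap p \<kappa>\<close> is the sphere with centre
  \<open>p / \<kappa>\<close> orthogonal to the unit sphere, and the function is positive outside that sphere. Multiplying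
  the usual equation by \<open>\<kappa>\<close> makes the family continuous down to \<open>\<kappa> = 0\<close>, where the mirror is the
  hyperplane orthogonal to \<open>p\<close>; as \<open>\<kappa>\<close> tends to 1 it shrinks to the point \<open>p\<close>.
\<close>
definition gap :: "'a::euclidean_space \<Rightarrow> real \<Rightarrow> 'a \<Rightarrow> real" where
  "gap p \<kappa> x = \<kappa> * (1 + x \<bullet> x) - 2 * (p \<bullet> x)"

text \<open>
  \<open>\<kappa>\<^sup>2\<close> times the squared distance from \<open>x\<close> to the centre \<open>p / \<kappa>\<close> of the mirror.
\<close>
definition mirror_den :: "'a::euclidean_space \<Rightarrow> real \<Rightarrow> 'a \<Rightarrow> real" where
  "mirror_den p \<kappa> x = (p - \<kappa> *\<^sub>R x) \<bullet> (p - \<kappa> *\<^sub>R x)"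

text \<open>
  The local dilation ratio of the inversion that has the zero set of \<open>gap p \<kappa>\<close> as its mirror.
\<close>
definition factor :: "'a::euclidean_space \<Rightarrow> real \<Rightarrow> 'a \<Rightarrow> real" where
  "factor p \<kappa> x = (1 - \<kappa>\<^sup>2) / mirror_den p \<kappa> x"

text \<open>
  The same inversion, which maps the closed unit ball to itself; for \<open>\<kappa> = 0\<close> it is the orthogonal
  reflection in a hyperplane. In contrast to \<open>inversion\<close> with centre \<open>p / \<kappa>\<close>, this expression has no
  singularity at \<open>\<kappa> = 0\<close>.
\<close>
definition reflect :: "'a::euclidean_space \<Rightarrow> real \<Rightarrow> 'a \<Rightarrow> 'a" where
  "reflect p \<kappa> x = (1 / mirror_den p \<kappa> x) *\<^sub>R ((1 - \<kappa>\<^sup>2) *\<^sub>R x + gap p \<kappa> x *\<^sub>R p)"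

lemma mirror_den_eq_gap:
  assumes "norm p = 1"
  shows "mirror_den p \<kappa> x = 1 - \<kappa>\<^sup>2 + \<kappa> * gap p \<kappa> x"
proof -
  have "p \<bullet> p = 1" using assms by (simp add: dot_square_norm)
  then show ?thesis
    by (simp add: mirror_den_def gap_def inner_diff_left inner_diff_right inner_commute power2_eq_square algebra_simps)
qed

lemma mirror_den_ge:
  assumes "norm p = 1" "0 \<le> \<kappa>" "\<kappa> < 1" "norm x \<le> 1"
  shows "(1 - \<kappa>)\<^sup>2 \<le> mirror_den p \<kappa> x"
proof -
  have "\<kappa> * norm x \<le> \<kappa> * 1" using assms by (intro mult_left_mono) auto
  moreover have "norm p - norm (\<kappa> *\<^sub>R x) \<le> norm (p - \<kappa> *\<^sub>R x)" by (rule norm_triangle_ineq2)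
  ultimately have "1 - \<kappa> \<le> norm (p - \<kappa> *\<^sub>R x)" using assms by simp
  then show ?thesis unfolding mirror_den_def dot_square_norm using assms by (intro power_mono) auto
qed

lemma mirror_den_pos:
  assumes "norm p = 1" "0 \<le> \<kappa>" "\<kappa> < 1" "norm x \<le> 1"
  shows "0 < mirror_den p \<kappa> x"
  using mirror_den_ge[OF assms] assms by (smt (verit) zero_less_power2)

lemma factor_pos:
  assumes "norm p = 1" "0 \<le> \<kappa>" "\<kappa> < 1" "norm x \<le> 1"
  shows "0 < factor p \<kappa> x"
  using mirror_den_pos[OF assms] assms by (simp add: factor_def power_less_one_iff abs_square_less_1)

lemma one_minus_factor:
  assumes "norm p = 1" "0 \<le> \<kappa>" "\<kappa> < 1" "norm x \<le> 1"
  shows "1 - factor p \<kappa> x = \<kappa> * gap p \<kappa> x / mirror_den p \<kappa> x"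
  using mirror_den_pos[OF assms] mirror_den_eq_gap[OF assms(1), of \<kappa> x] by (simp add: factor_def field_simps)

lemma reflect_minus:
  assumes "norm p = 1" "0 \<le> \<kappa>" "\<kappa> < 1" "norm x \<le> 1"
  shows "reflect p \<kappa> x - x = (gap p \<kappa> x / mirror_den p \<kappa> x) *\<^sub>R (p - \<kappa> *\<^sub>R x)"
proof -
  let ?d = "mirror_den p \<kappa> x"
  have "reflect p \<kappa> x - x = (1 / ?d) *\<^sub>R ((1 - \<kappa>\<^sup>2) *\<^sub>R x + gap p \<kappa> x *\<^sub>R p - ?d *\<^sub>R x)"
    using mirror_den_pos[OF assms] by (simp add: reflect_def scaleR_diff_right)
  also have "(1 - \<kappa>\<^sup>2) *\<^sub>R x + gap p \<kappa> x *\<^sub>R p - ?d *\<^sub>R x = gap p \<kappa> x *\<^sub>R (p - \<kappa> *\<^sub>R x)"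
    unfolding mirror_den_eq_gap[OF assms(1)] by (simp add: algebra_simps)
  finally show ?thesis by simp
qed

lemma reflect_inner:
  assumes "norm p = 1" "0 \<le> \<kappa>" "\<kappa> < 1" "norm x \<le> 1"
  shows "1 - reflect p \<kappa> x \<bullet> reflect p \<kappa> x = factor p \<kappa> x * (1 - x \<bullet> x)"
proof -
  define P X D where "P = p \<bullet> x" and "X = x \<bullet> x" and "D = mirror_den p \<kappa> x"
  have D: "D > 0" using mirror_den_pos[OF assms] by (simp add: D_def)
  have g: "gap p \<kappa> x = \<kappa> * (1 + X) - 2 * P" by (simp add: gap_def X_def P_def)
  have De: "D = 1 - 2 * \<kappa> * P + \<kappa>\<^sup>2 * X"
    unfolding D_def mirror_den_eq_gap[OF assms(1)] g by (simp add: power2_eq_square algebra_simps)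
  have pp: "p \<bullet> p = 1" using assms by (simp add: dot_square_norm)
  have "((1 - \<kappa>\<^sup>2) *\<^sub>R x + gap p \<kappa> x *\<^sub>R p) \<bullet> ((1 - \<kappa>\<^sup>2) *\<^sub>R x + gap p \<kappa> x *\<^sub>R p)
      = (1 - \<kappa>\<^sup>2)\<^sup>2 * X + 2 * (1 - \<kappa>\<^sup>2) * gap p \<kappa> x * P + (gap p \<kappa> x)\<^sup>2"
    by (simp add: inner_add_left inner_add_right pp P_def X_def inner_commute power2_eq_square algebra_simps)
  also have "\<dots> = D\<^sup>2 - (1 - \<kappa>\<^sup>2) * D * (1 - X)"
    unfolding g De by algebra
  finally have "reflect p \<kappa> x \<bullet> reflect p \<kappa> x = (1 / D\<^sup>2) * (D\<^sup>2 - (1 - \<kappa>\<^sup>2) * D * (1 - X))"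
    by (simp add: reflect_def D_def power2_eq_square)
  also have "\<dots> = 1 - (1 - \<kappa>\<^sup>2) / D * (1 - X)"
    using D by (simp add: right_diff_distrib power2_eq_square)
  finally show ?thesis by (simp add: factor_def D_def X_def)
qed

lemma reflect_in_cball:
  assumes "norm p = 1" "0 \<le> \<kappa>" "\<kappa> < 1" "norm x \<le> 1"
  shows "norm (reflect p \<kappa> x) \<le> 1" "norm x < 1 \<Longrightarrow> norm (reflect p \<kappa> x) < 1"
    "norm x = 1 \<Longrightarrow> norm (reflect p \<kappa> x) = 1"
proof -
  have e: "1 - (norm (reflect p \<kappa> x))\<^sup>2 = factor p \<kappa> x * (1 - (norm x)\<^sup>2)"
    using reflect_inner[OF assms] by (simp add: dot_square_norm)
  note f = factor_pos[OF assms]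
  have "0 \<le> factor p \<kappa> x * (1 - (norm x)\<^sup>2)"
    using f assms by (intro mult_nonneg_nonneg) (auto simp: power_le_one)
  with e have "(norm (reflect p \<kappa> x))\<^sup>2 \<le> 1" by linarith
  then show "norm (reflect p \<kappa> x) \<le> 1" by (simp add: abs_square_le_1)
  show "norm (reflect p \<kappa> x) < 1" if "norm x < 1"
  proof -
    have "0 < factor p \<kappa> x * (1 - (norm x)\<^sup>2)"
      using f that by (intro mult_pos_pos) (auto simp: power_less_one_iff)
    with e have "(norm (reflect p \<kappa> x))\<^sup>2 < 1" by linarith
    then show ?thesis by (simp add: abs_square_less_1)
  qed
  show "norm (reflect p \<kappa> x) = 1" if "norm x = 1"
    using e that norm_ge_zero[of "reflect p \<kappa> x"] by (auto simp: power2_eq_1_iff)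
qed

lemma center_dist:
  assumes "0 < \<kappa>"
  shows "(x - (1 / \<kappa>) *\<^sub>R p) \<bullet> (x - (1 / \<kappa>) *\<^sub>R p) = mirror_den p \<kappa> x / \<kappa>\<^sup>2"
proof -
  have "p - \<kappa> *\<^sub>R x = (- \<kappa>) *\<^sub>R (x - (1 / \<kappa>) *\<^sub>R p)" using assms by (simp add: algebra_simps)
  then show ?thesis using assms by (simp add: mirror_den_def power2_eq_square)
qed

lemma factor_eq:
  assumes "0 < \<kappa>"
  shows "factor p \<kappa> x = (1 / \<kappa>\<^sup>2 - 1) / ((x - (1 / \<kappa>) *\<^sub>R p) \<bullet> (x - (1 / \<kappa>) *\<^sub>R p))"
proof -
  have "1 / \<kappa>\<^sup>2 - 1 = (1 - \<kappa>\<^sup>2) / \<kappa>\<^sup>2" using assms by (simp add: diff_divide_distrib)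
  then show ?thesis unfolding center_dist[OF assms] using assms by (simp add: factor_def)
qed

lemma reflect_eq_inversion:
  assumes "0 < \<kappa>" "norm p = 1" "mirror_den p \<kappa> x \<noteq> 0"
  shows "reflect p \<kappa> x = inversion ((1 / \<kappa>) *\<^sub>R p) (1 / \<kappa>\<^sup>2 - 1) x"
proof -
  let ?d = "mirror_den p \<kappa> x"
  have "inversion ((1 / \<kappa>) *\<^sub>R p) (1 / \<kappa>\<^sup>2 - 1) x =
      (1 / \<kappa>) *\<^sub>R p + factor p \<kappa> x *\<^sub>R (x - (1 / \<kappa>) *\<^sub>R p)"
    by (simp add: inversion_def factor_eq[OF assms(1)])
  also have "\<dots> = factor p \<kappa> x *\<^sub>R x + ((1 - factor p \<kappa> x) / \<kappa>) *\<^sub>R p"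
    by (simp add: algebra_simps diff_divide_distrib)
  also have "(1 - factor p \<kappa> x) / \<kappa> = gap p \<kappa> x / ?d"
    using assms mirror_den_eq_gap[OF assms(2), of \<kappa> x] by (simp add: factor_def field_simps)
  finally show ?thesis by (simp add: reflect_def factor_def scaleR_add_right)
qed

lemma factor_le_1:
  assumes "norm p = 1" "0 \<le> \<kappa>" "\<kappa> < 1" "norm x \<le> 1" "0 \<le> gap p \<kappa> x"
  shows "factor p \<kappa> x \<le> 1"
  using one_minus_factor[OF assms(1-4)] mirror_den_pos[OF assms(1-4)] assms
  by (smt (verit) divide_nonneg_nonneg mult_nonneg_nonneg)

lemma factor_less_1:
  assumes "norm p = 1" "0 < \<kappa>" "\<kappa> < 1" "norm x \<le> 1" "0 < gap p \<kappa> x"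
  shows "factor p \<kappa> x < 1"
proof -
  have "0 < \<kappa> * gap p \<kappa> x / mirror_den p \<kappa> x" using mirror_den_pos[of p \<kappa> x] assms by simp
  then show ?thesis using one_minus_factor[of p \<kappa> x] assms by simp
qed

lemma gap_zero:
  assumes "norm p = 1" "0 \<le> \<kappa>" "\<kappa> < 1" "norm x \<le> 1" "gap p \<kappa> x = 0"
  shows "factor p \<kappa> x = 1" "reflect p \<kappa> x = x"
  using one_minus_factor[OF assms(1-4)] reflect_minus[OF assms(1-4)] assms by auto

lemma has_grad_lap_gap:
  "has_grad_lap (gap p \<kappa>) (2 *\<^sub>R (\<kappa> *\<^sub>R x - p)) (2 * \<kappa> * DIM('a)) (x::'a::euclidean_space)"
proof -
  have "has_grad_lap (\<lambda>x. \<kappa> * (1 + (x - 0) \<bullet> (x - 0)) - 2 * (p \<bullet> x))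
     (\<kappa> *\<^sub>R (0 + 2 *\<^sub>R (x - 0)) - 2 *\<^sub>R p) (\<kappa> * (0 + 2 * real DIM('a)) - 2 * 0) x"
    by (intro has_grad_lap_diff has_grad_lap_cmult has_grad_lap_add has_grad_lap_const
        has_grad_lap_norm_sq has_grad_lap_inner)
  then show ?thesis unfolding gap_def[abs_def] by (simp add: algebra_simps)
qed

lemma gap_mono: "\<kappa> \<le> \<kappa>' \<Longrightarrow> gap p \<kappa> x \<le> gap p \<kappa>' x"
  by (simp add: gap_def mult_right_mono)

lemma continuous_on_gap: "continuous_on S (gap p \<kappa>)"
  unfolding gap_def[abs_def] by (intro continuous_intros)

lemma connected_cap:
  assumes "0 < \<kappa>"
  shows "connected {x \<in> ball 0 1. 0 < gap p \<kappa> x}" (is "connected ?D")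
proof -
  have "starlike ?D"
    unfolding starlike_def
  proof (intro bexI ballI)
    show "(0::'a) \<in> ?D" using assms by (simp add: gap_def)
    fix x assume x: "x \<in> ?D"
    show "closed_segment 0 x \<subseteq> ?D"
    proof
      fix y assume "y \<in> closed_segment 0 x"
      then obtain t where t: "0 \<le> t" "t \<le> 1" "y = t *\<^sub>R x" by (auto simp: in_segment)
      have "norm y \<le> norm x" using t by (simp add: mult_left_le_one_le)
      moreover have "0 < gap p \<kappa> y"
      proof (cases "t = 0")
        case False
        have xx: "x \<bullet> x \<le> 1" using x by (simp add: dot_square_norm abs_square_le_1)
        \<comment> \<open>The cap is starlike about the origin although \<open>gap p \<kappa>\<close> is convex and not concave:
            \<open>gap p \<kappa> (t x) / t\<close> decreases in \<open>t\<close> on \<open>{0<..1}\<close>, so it stays above its value at \<open>t = 1\<close>.\<close>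
        have "gap p \<kappa> y = t * gap p \<kappa> x + \<kappa> * ((1 - t) * (1 - t * (x \<bullet> x)))"
          unfolding gap_def t(3) by (simp add: algebra_simps)
        moreover have "t * (x \<bullet> x) \<le> 1" using t xx by (simp add: mult_le_one)
        then have "0 \<le> \<kappa> * ((1 - t) * (1 - t * (x \<bullet> x)))" using assms t by simp
        ultimately show ?thesis using x t False by (simp add: add_pos_nonneg)
      qed (use t assms in \<open>simp add: gap_def\<close>)
      ultimately show "y \<in> ?D" using x by auto
    qed
  qed
  then show ?thesis by (rule starlike_imp_connected)
qed

text \<open>
  The barrier for the region next to the mirror. The exponential supplies a large normal derivative on
  the unit sphere; the square of \<open>gap p \<kappa>\<close>, whose gradient does not vanish, is strictly subharmonic
  and compensates for the Laplacian of the exponential. As \<open>gap p \<kappa>\<close> is small near the mirror, the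
  sum remains positive there. It is smooth across the corner between the mirror and the sphere and
  keeps both properties there, so it also serves where a Hopf type argument would be delicate.
\<close>
lemma barrier:
  fixes p :: "'a::euclidean_space"
  assumes p: "norm p = 1" and \<kappa>: "0 < \<kappa>" "\<kappa> < 1" and x: "norm x \<le> 1" and k: "0 \<le> k" and M: "0 \<le> M"
    and s: "0 \<le> gap p \<kappa> x"
  shows "\<exists>g L. has_grad_lap (\<lambda>x. 1 + exp (k * (x \<bullet> x - 1)) - M * (gap p \<kappa> x * gap p \<kappa> x)) g L x
     \<and> L \<le> 2 * k * DIM('a) + 4 * k\<^sup>2 - 8 * M * (1 - \<kappa>)\<^sup>2
     \<and> (norm x = 1 \<longrightarrow> g \<bullet> x = 2 * k - 2 * M * (gap p \<kappa> x)\<^sup>2)"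
proof -
  let ?E = "exp (k * (x \<bullet> x - 1))" and ?s = "gap p \<kappa> x" and ?d = "2 *\<^sub>R (\<kappa> *\<^sub>R x - p)"
  let ?g = "0 + (2 * k * ?E) *\<^sub>R x - M *\<^sub>R (?s *\<^sub>R ?d + ?s *\<^sub>R ?d)"
  let ?L = "0 + ?E * (2 * k * DIM('a) + 4 * k\<^sup>2 * (x \<bullet> x)) - M * (?s * (2 * \<kappa> * DIM('a)) + ?s * (2 * \<kappa> * DIM('a)) + 2 * (?d \<bullet> ?d))"
  have "has_grad_lap (\<lambda>x. 1 + exp (k * (x \<bullet> x - 1)) - M * (gap p \<kappa> x * gap p \<kappa> x)) ?g ?L x"
    by (intro has_grad_lap_diff has_grad_lap_add has_grad_lap_const has_grad_lap_exp_norm_sq[of k 0 1 x, simplified]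
        has_grad_lap_cmult has_grad_lap_mult has_grad_lap_gap)
  moreover have "?L \<le> 2 * k * DIM('a) + 4 * k\<^sup>2 - 8 * M * (1 - \<kappa>)\<^sup>2"
  proof -
    have xx: "x \<bullet> x \<le> 1" using x by (simp add: dot_square_norm abs_square_le_1)
    have "?E \<le> 1" using k xx by (simp add: mult_nonneg_nonpos)
    moreover have "2 * k * DIM('a) + 4 * k\<^sup>2 * (x \<bullet> x) \<le> 2 * k * DIM('a) + 4 * k\<^sup>2"
      using xx by (simp add: mult_left_le)
    ultimately have "?E * (2 * k * DIM('a) + 4 * k\<^sup>2 * (x \<bullet> x)) \<le> 1 * (2 * k * DIM('a) + 4 * k\<^sup>2)"
      using k by (intro mult_mono) auto
    moreover have "?d \<bullet> ?d = 4 * mirror_den p \<kappa> x"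
      by (simp add: mirror_den_def inner_diff_left inner_diff_right inner_commute algebra_simps)
    then have "4 * (1 - \<kappa>)\<^sup>2 \<le> ?d \<bullet> ?d" using mirror_den_ge[of p \<kappa> x] p \<kappa> x by simp
    then have "8 * (1 - \<kappa>)\<^sup>2 \<le> ?s * (2 * \<kappa> * DIM('a)) + ?s * (2 * \<kappa> * DIM('a)) + 2 * (?d \<bullet> ?d)"
      using s \<kappa> by (smt (verit) mult_nonneg_nonneg of_nat_0_le_iff)
    then have "M * (8 * (1 - \<kappa>)\<^sup>2) \<le> M * (?s * (2 * \<kappa> * DIM('a)) + ?s * (2 * \<kappa> * DIM('a)) + 2 * (?d \<bullet> ?d))"
      using M by (rule mult_left_mono)
    ultimately show ?thesis by simp
  qed
  moreover have "?g \<bullet> x = 2 * k - 2 * M * ?s\<^sup>2" if "norm x = 1"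
  proof -
    have xx: "x \<bullet> x = 1" using that by (simp add: dot_square_norm)
    have "?d \<bullet> x = ?s" using xx by (simp add: gap_def inner_diff_left)
    then have "(?s *\<^sub>R ?d + ?s *\<^sub>R ?d) \<bullet> x = 2 * ?s\<^sup>2" by (simp only: inner_add_left inner_scaleR_left[of ?s] power2_eq_square)
    then show ?thesis using xx by (simp only: inner_diff_left inner_add_left inner_scaleR_left[of M]) simp
  qed
  ultimately show ?thesis by blast
qed

section \<open>The solution and its Kelvin transforms\<close>

text \<open>
  The solution is replaced by a smooth extension \<open>U\<close> beyond the closed ball with gradient \<open>G\<close>, so
  that ordinary two-sided derivatives are available at the sphere. The hypothesis on \<open>q\<close> is written as
  \<open>m q < m + 1\<close>, the form in which subcriticality enters: it makes the exponent
  \<open>m + 1 - m q\<close> of the conformal factor in the transformed boundary condition positive.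
\<close>
locale positive_robin_solution =
  fixes U :: "'a::euclidean_space \<Rightarrow> real" and G :: "'a \<Rightarrow> 'a" and q a m :: real
  assumes m_def: "m = (real DIM('a) - 2) / 2" and m_ge: "1 / 2 \<le> m"
    and q_gt: "1 < q" and subcritical: "m * q < m + 1" and a_nonneg: "0 \<le> a" and a_le: "a \<le> m"
    and U_pos: "\<And>x. norm x \<le> 1 \<Longrightarrow> 0 < U x"
    and U_diff: "\<And>x. norm x \<le> 1 \<Longrightarrow> \<exists>L. has_grad_lap U (G x) L x"
    and U_harmonic: "\<And>x. norm x < 1 \<Longrightarrow> has_grad_lap U (G x) 0 x"
    and G_cont: "continuous_on (cball 0 1) G"
    and robin: "\<And>x. norm x = 1 \<Longrightarrow> G x \<bullet> x + a * U x = U x powr q"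

begin

lemma U_cont: "continuous_on (cball 0 1) U"
proof (intro continuous_at_imp_continuous_on ballI)
  fix x :: 'a assume "x \<in> cball 0 1"
  then obtain L where "has_grad_lap U (G x) L x" using U_diff by auto
  then show "isCont U x"
    using has_grad_lap_imp_has_derivative has_derivative_continuous by blast
qed

text \<open>
  The Kelvin transform of \<open>U\<close> with respect to the mirror. The weight makes it harmonic again.
\<close>
definition kelvin :: "'a \<Rightarrow> real \<Rightarrow> 'a \<Rightarrow> real" where
  "kelvin p \<kappa> x = factor p \<kappa> x powr m * U (reflect p \<kappa> x)"

lemma kelvin_pos:
  assumes "norm p = 1" "0 \<le> \<kappa>" "\<kappa> < 1" "norm x \<le> 1"
  shows "0 < kelvin p \<kappa> x"
  using factor_pos[OF assms] U_pos[OF reflect_in_cball(1)[OF assms]] by (simp add: kelvin_def)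

lemma kelvin_gap_zero:
  assumes "norm p = 1" "0 \<le> \<kappa>" "\<kappa> < 1" "norm x \<le> 1" "gap p \<kappa> x = 0"
  shows "kelvin p \<kappa> x = U x"
  using gap_zero[OF assms] by (simp add: kelvin_def)

text \<open>
  The Robin operator \<open>\<partial>\<^sub>\<nu> + m\<close> is conformally covariant, because the mirror is orthogonal to the sphere
  and the reflection maps outer normals to outer normals.
\<close>
lemma kelvin_diff:
  assumes p: "norm p = 1" and \<kappa>: "0 < \<kappa>" "\<kappa> < 1" and x: "norm x \<le> 1"
  shows "\<exists>g L. has_grad_lap (kelvin p \<kappa>) g L x \<and> (norm x < 1 \<longrightarrow> L = 0) \<and>
     (norm x = 1 \<longrightarrow> g \<bullet> x = factor p \<kappa> x powr m * (factor p \<kappa> x *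
        (G (reflect p \<kappa> x) \<bullet> reflect p \<kappa> x + m * U (reflect p \<kappa> x))) - m * kelvin p \<kappa> x)"
proof -
  have \<kappa>0: "0 \<le> \<kappa>" using \<kappa> by simp
  define c \<rho> where "c = (1 / \<kappa>) *\<^sub>R p" and "\<rho> = 1 / \<kappa>\<^sup>2 - 1"
  define \<sigma> where "\<sigma> = reflect p \<kappa> x"
  define z where "z = x - c"
  define N where "N = z \<bullet> z"
  define l where "l = factor p \<kappa> x"
  have \<rho>: "0 < \<rho>" using \<kappa> by (simp add: \<rho>_def power_less_one_iff)
  have N: "N = mirror_den p \<kappa> x / \<kappa>\<^sup>2" using center_dist[OF \<kappa>(1)] by (simp add: N_def z_def c_def)
  then have Npos: "0 < N" using mirror_den_pos[OF p \<kappa>0 \<kappa>(2) x] \<kappa> by simp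
  then have xc: "x \<noteq> c" by (auto simp: N_def z_def)
  have lN: "l = \<rho> / N" using factor_eq[OF \<kappa>(1)] by (simp add: l_def \<rho>_def N_def z_def c_def)
  have \<sigma>i: "\<sigma> = inversion c \<rho> x"
    unfolding \<sigma>_def c_def \<rho>_def using mirror_den_pos[OF p \<kappa>0 \<kappa>(2) x] \<kappa> p by (intro reflect_eq_inversion) auto
  obtain L where L: "has_grad_lap U (G \<sigma>) L \<sigma>" "norm x < 1 \<Longrightarrow> L = 0"
    using U_diff U_harmonic reflect_in_cball[OF p \<kappa>0 \<kappa>(2) x] unfolding \<sigma>_def by (metis less_le_not_le linorder_not_le)
  let ?g = "l powr m *\<^sub>R (l *\<^sub>R (G \<sigma> - (2 * (z \<bullet> G \<sigma>) / N) *\<^sub>R z) - (2 * m * U \<sigma> / N) *\<^sub>R z)"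
  have kel: "has_grad_lap (\<lambda>x. (\<rho> / ((x - c) \<bullet> (x - c))) powr m * U (inversion c \<rho> x))
       ?g (l powr m * l\<^sup>2 * L) x"
    using has_grad_lap_kelvin[OF xc \<rho> L(1)[unfolded \<sigma>i] m_def]
    unfolding lN \<sigma>i N_def z_def .
  have V: "has_grad_lap (kelvin p \<kappa>) ?g (l powr m * l\<^sup>2 * L) x"
  proof (rule has_grad_lap_transform[OF kel, of "- {c}"])
    fix y assume "y \<in> - {c}"
    then have "mirror_den p \<kappa> y \<noteq> 0" using center_dist[OF \<kappa>(1), of y p] by (auto simp: c_def)
    then show "(\<rho> / ((y - c) \<bullet> (y - c))) powr m * U (inversion c \<rho> y) = kelvin p \<kappa> y"
      unfolding kelvin_def reflect_eq_inversion[OF \<kappa>(1) p \<open>mirror_den p \<kappa> y \<noteq> 0\<close>] factor_eq[OF \<kappa>(1)]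
      by (simp add: c_def \<rho>_def)
  qed (use xc in auto)
  have "?g \<bullet> x = l powr m * (l * (G \<sigma> \<bullet> \<sigma> + m * U \<sigma>)) - m * kelvin p \<kappa> x" if nx: "norm x = 1"
  proof -
    have pp: "p \<bullet> p = 1" and xx: "x \<bullet> x = 1" using p nx by (auto simp: dot_square_norm)
    have cc: "c \<bullet> c = \<rho> + 1" using pp by (simp add: c_def \<rho>_def power2_eq_square)
    have "2 * (z \<bullet> x) = N - \<rho>"
      unfolding N_def z_def using cc xx by (simp add: inner_diff_left inner_diff_right inner_commute)
    then have zx: "2 * (z \<bullet> x) / N = 1 - l" using Npos by (simp add: lN diff_divide_distrib)
    \<comment> \<open>The differential of an inversion is symmetric, so it can be moved from the gradient to \<open>x\<close>.
        For an inversion preserving the sphere it sends the normal \<open>x\<close> to \<open>l *\<^sub>R \<sigma>\<close>, a multiple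
        of the normal at the image.\<close>
    have \<sigma>z: "\<sigma> = x - (1 - l) *\<^sub>R z"
      unfolding \<sigma>i inversion_def using lN by (simp add: N_def z_def algebra_simps)
    have "(G \<sigma> - (2 * (z \<bullet> G \<sigma>) / N) *\<^sub>R z) \<bullet> x = G \<sigma> \<bullet> x - (2 * (z \<bullet> x) / N) * (z \<bullet> G \<sigma>)"
      by (simp add: inner_diff_left mult.commute mult.left_commute)
    also have "\<dots> = G \<sigma> \<bullet> \<sigma>"
      unfolding zx \<sigma>z[THEN arg_cong[of _ _ "\<lambda>t. v \<bullet> t" for v]] by (simp add: inner_diff_right inner_commute)
    finally have 1: "(G \<sigma> - (2 * (z \<bullet> G \<sigma>) / N) *\<^sub>R z) \<bullet> x = G \<sigma> \<bullet> \<sigma>" .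
    have "(2 * m * U \<sigma> / N) * (z \<bullet> x) = m * U \<sigma> * (2 * (z \<bullet> x) / N)" by simp
    then have 2: "(2 * m * U \<sigma> / N) * (z \<bullet> x) = m * U \<sigma> * (1 - l)" unfolding zx .
    have "?g \<bullet> x = l powr m * (l * ((G \<sigma> - (2 * (z \<bullet> G \<sigma>) / N) *\<^sub>R z) \<bullet> x) - (2 * m * U \<sigma> / N) * (z \<bullet> x))"
      by (simp add: inner_diff_left)
    also have "\<dots> = l powr m * (l * (G \<sigma> \<bullet> \<sigma> + m * U \<sigma>)) - m * kelvin p \<kappa> x"
      unfolding 1 2 kelvin_def l_def[symmetric] \<sigma>_def[symmetric] by (simp add: algebra_simps)
    finally show ?thesis .
  qed
  then show ?thesis using V L(2) unfolding l_def \<sigma>_def by (intro exI[of _ ?g] exI conjI) (auto simp: l_def \<sigma>_def)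
qed

definition excess :: "'a \<Rightarrow> real \<Rightarrow> 'a \<Rightarrow> real" where "excess p \<kappa> x = U x - kelvin p \<kappa> x"

text \<open>
  Rewriting the boundary condition at the reflected point in terms of the Kelvin transform turns
  the nonlinearity \<open>U powr q + (m - a) * U\<close> into the same expression with powers of the conformal
  factor as coefficients, whose exponents are \<open>m + 1 - m * q > 0\<close> and 1. In the region
  \<open>gap p \<kappa> > 0\<close> these coefficients are less than one, which favours \<open>U\<close> over its Kelvin transform.
\<close>
lemma excess_diff:
  assumes p: "norm p = 1" and \<kappa>: "0 < \<kappa>" "\<kappa> < 1" and x: "norm x \<le> 1"
  shows "\<exists>g L. has_grad_lap (excess p \<kappa>) g L x \<and> (norm x < 1 \<longrightarrow> L = 0) \<and>
     (norm x = 1 \<longrightarrow> g \<bullet> x = U x powr q - a * U x + m * kelvin p \<kappa> x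
        - factor p \<kappa> x powr (m + 1 - m * q) * kelvin p \<kappa> x powr q - (m - a) * (factor p \<kappa> x * kelvin p \<kappa> x))"
proof -
  have \<kappa>0: "0 \<le> \<kappa>" using \<kappa> by simp
  let ?l = "factor p \<kappa> x" and ?\<sigma> = "reflect p \<kappa> x"
  obtain g L where g: "has_grad_lap (kelvin p \<kappa>) g L x" "norm x < 1 \<longrightarrow> L = 0"
     "norm x = 1 \<longrightarrow> g \<bullet> x = ?l powr m * (?l * (G ?\<sigma> \<bullet> ?\<sigma> + m * U ?\<sigma>)) - m * kelvin p \<kappa> x"
    using kelvin_diff[OF assms] by blast
  obtain L' where L': "has_grad_lap U (G x) L' x" "norm x < 1 \<Longrightarrow> L' = 0"
    using U_diff U_harmonic x by (metis less_le_not_le linorder_not_le)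
  have "(G x - g) \<bullet> x = U x powr q - a * U x + m * kelvin p \<kappa> x
        - ?l powr (m + 1 - m * q) * kelvin p \<kappa> x powr q - (m - a) * (?l * kelvin p \<kappa> x)" if nx: "norm x = 1"
  proof -
    have l: "0 < ?l" by (rule factor_pos[OF p \<kappa>0 \<kappa>(2) x])
    have n\<sigma>: "norm ?\<sigma> = 1" using reflect_in_cball(3)[OF p \<kappa>0 \<kappa>(2) x nx] .
    then have u\<sigma>: "0 < U ?\<sigma>" using U_pos by simp
    have G\<sigma>: "G ?\<sigma> \<bullet> ?\<sigma> = U ?\<sigma> powr q - a * U ?\<sigma>" using robin[OF n\<sigma>] by simp
    have scale: "?l powr m * ?l * U ?\<sigma> powr q = ?l powr (m + 1 - m * q) * kelvin p \<kappa> x powr q"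
    proof -
      have "kelvin p \<kappa> x powr q = ?l powr (m * q) * U ?\<sigma> powr q"
        unfolding kelvin_def using l u\<sigma> by (simp add: powr_mult powr_powr)
      then have "?l powr (m + 1 - m * q) * kelvin p \<kappa> x powr q = ?l powr (m + 1) * U ?\<sigma> powr q"
        by (simp add: powr_add[symmetric] mult.assoc[symmetric])
      then show ?thesis using l by (simp add: powr_add)
    qed
    have "?l powr m * (?l * (G ?\<sigma> \<bullet> ?\<sigma> + m * U ?\<sigma>)) =
        ?l powr (m + 1 - m * q) * kelvin p \<kappa> x powr q + (m - a) * (?l * kelvin p \<kappa> x)"
      unfolding scale[symmetric] G\<sigma> by (simp add: kelvin_def algebra_simps)
    moreover have "G x \<bullet> x = U x powr q - a * U x" using robin[OF nx] by simp
    ultimately show ?thesis using g(3) nx by (simp add: inner_diff_left)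
  qed
  moreover have "has_grad_lap (excess p \<kappa>) (G x - g) (L' - L) x"
    unfolding excess_def[abs_def] by (rule has_grad_lap_diff[OF L'(1) g(1)])
  ultimately show ?thesis using g L' by (intro exI[of _ "G x - g"] exI[of _ "L' - L"]) auto
qed

text \<open>
  Joint continuity in the parameter and the point, including the limit case \<open>\<kappa> = 0\<close>.
\<close>
lemma kelvin_cont:
  assumes "norm p = 1" "\<kappa>1 < 1"
  shows "continuous_on ({0..\<kappa>1} \<times> cball 0 1) (\<lambda>y. kelvin p (fst y) (snd y))"
proof -
  let ?S = "{0..\<kappa>1} \<times> (cball 0 1 :: 'a set)"
  have d: "mirror_den p (fst y) (snd y) \<noteq> 0" "factor p (fst y) (snd y) \<noteq> 0"
      "reflect p (fst y) (snd y) \<in> cball 0 1" if "y \<in> ?S" for y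
    using that mirror_den_pos[of p "fst y" "snd y"] factor_pos[of p "fst y" "snd y"]
      reflect_in_cball(1)[of p "fst y" "snd y"] assms by auto
  have den: "continuous_on ?S (\<lambda>y. mirror_den p (fst y) (snd y))"
    unfolding mirror_den_def by (intro continuous_intros)
  have gap: "continuous_on ?S (\<lambda>y. gap p (fst y) (snd y))"
    unfolding gap_def by (intro continuous_intros)
  have fac: "continuous_on ?S (\<lambda>y. factor p (fst y) (snd y))"
    unfolding factor_def by (intro continuous_intros den) (use d in auto)
  have ref: "continuous_on ?S (\<lambda>y. reflect p (fst y) (snd y))"
    unfolding reflect_def by (intro continuous_intros den gap) (use d in auto)
  show ?thesis
    unfolding kelvin_def
    by (intro continuous_intros fac continuous_on_compose2[OF U_cont ref]) (use d in auto)
qed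

lemma excess_cont:
  assumes "norm p = 1" "\<kappa>1 < 1"
  shows "continuous_on ({0..\<kappa>1} \<times> cball 0 1) (\<lambda>y. excess p (fst y) (snd y))"
  unfolding excess_def
  by (intro continuous_intros kelvin_cont assms continuous_on_compose2[OF U_cont]) auto

lemma excess_cont_space:
  assumes "norm p = 1" "0 \<le> \<kappa>" "\<kappa> < 1"
  shows "continuous_on (cball 0 1) (excess p \<kappa>)"
proof -
  have "continuous_on (cball 0 1) (\<lambda>x. excess p (fst (\<kappa>, x)) (snd (\<kappa>, x)))"
    by (rule continuous_on_compose2[OF excess_cont[OF assms(1,3)]]) (use assms in \<open>auto intro!: continuous_intros\<close>)
  then show ?thesis by simp
qed

lemma excess_cont_parameter:
  assumes "norm p = 1" "\<kappa>1 < 1" "norm x \<le> 1"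
  shows "continuous_on {0..\<kappa>1} (\<lambda>\<kappa>. excess p \<kappa> x)"
proof -
  have "continuous_on {0..\<kappa>1} (\<lambda>\<kappa>. excess p (fst (\<kappa>, x)) (snd (\<kappa>, x)))"
    by (rule continuous_on_compose2[OF excess_cont[OF assms(1,2)]]) (use assms in \<open>auto intro!: continuous_intros\<close>)
  then show ?thesis by simp
qed

section \<open>Moving the mirror\<close>

definition dominates :: "'a \<Rightarrow> real \<Rightarrow> bool" where
  "dominates p \<kappa> \<longleftrightarrow> (\<forall>x. norm x \<le> 1 \<longrightarrow> 0 \<le> gap p \<kappa> x \<longrightarrow> 0 \<le> excess p \<kappa> x)"

text \<open>
  A point in the region for \<open>\<kappa>\<close> lies in the region for every larger parameter, as \<open>gap\<close> increases
  with \<open>\<kappa>\<close>; so the inequality passes to the limit.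
\<close>
lemma dominates_closed:
  assumes p: "norm p = 1" and \<kappa>: "0 \<le> \<kappa>" "\<kappa> < 1" and dom: "\<And>t. \<kappa> < t \<Longrightarrow> t < 1 \<Longrightarrow> dominates p t"
  shows "dominates p \<kappa>"
  unfolding dominates_def
proof (intro allI impI)
  fix x :: 'a assume x: "norm x \<le> 1" "0 \<le> gap p \<kappa> x"
  define b where "b = (\<kappa> + 1) / 2"
  have b: "\<kappa> < b" "b < 1" using \<kappa> by (auto simp: b_def)
  have "continuous (at \<kappa> within {0..b}) (\<lambda>t. excess p t x)"
    using excess_cont_parameter[OF p b(2) x(1)] \<kappa> b by (simp add: continuous_on_eq_continuous_within)
  then have "((\<lambda>t. excess p t x) \<longlongrightarrow> excess p \<kappa> x) (at \<kappa> within {\<kappa>..b})"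
    unfolding continuous_within by (rule tendsto_within_subset) (use \<kappa> in auto)
  then have "((\<lambda>t. excess p t x) \<longlongrightarrow> excess p \<kappa> x) (at_right \<kappa>)"
    using b by (simp add: at_within_Icc_at_right)
  moreover have "\<forall>\<^sub>F t in at_right \<kappa>. 0 \<le> excess p t x"
    using eventually_at_right_less[of \<kappa>] eventually_at_rightI[of \<kappa> b "\<lambda>t. t < b", OF _ b(1), simplified]
  proof eventually_elim
    case (elim t)
    then show ?case using dom[of t] x gap_mono[of \<kappa> t p x] b unfolding dominates_def by auto
  qed
  ultimately show "0 \<le> excess p \<kappa> x" by (rule tendsto_lowerbound) simp
qed

text \<open>
  At a zero on the sphere both functions agree, and the boundary condition gives a strictly positive
  outer normal derivative of their difference because the conformal factor is less than one; but at a
  boundary minimum it is nonpositive. The interior is covered by the strong minimum principle.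
\<close>
lemma dominates_strict:
  assumes p: "norm p = 1" and \<kappa>: "0 < \<kappa>" "\<kappa> < 1" and dom: "dominates p \<kappa>"
    and x: "norm x \<le> 1" "0 < gap p \<kappa> x"
  shows "0 < excess p \<kappa> x"
proof -
  have \<kappa>0: "0 \<le> \<kappa>" using \<kappa> by simp
  have gapopen: "open {x. 0 < gap p \<kappa> x}"
    using continuous_on_gap[of UNIV p \<kappa>] by (intro open_Collect_less continuous_on_const) auto
  have boundary: "excess p \<kappa> y \<noteq> 0" if y: "norm y = 1" "0 < gap p \<kappa> y" for y
  proof
    assume 0: "excess p \<kappa> y = 0"
    obtain g L where g: "has_grad_lap (excess p \<kappa>) g L y"
      "g \<bullet> y = U y powr q - a * U y + m * kelvin p \<kappa> y
        - factor p \<kappa> y powr (m + 1 - m * q) * kelvin p \<kappa> y powr q - (m - a) * (factor p \<kappa> y * kelvin p \<kappa> y)"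
      using excess_diff[OF p \<kappa>, of y] y by auto
    have "\<forall>\<^sub>F t in at_left 1. excess p \<kappa> y \<le> excess p \<kappa> (t *\<^sub>R y)"
      using eventually_radial_in_ball[OF y(1) gapopen] y(2)
      by (auto elim!: eventually_mono simp: 0 dominates_def intro!: dom[unfolded dominates_def, rule_format])
    then have "g \<bullet> y \<le> 0"
      by (rule radial_derivative_nonpos[OF has_grad_lap_imp_has_derivative[OF g(1)]])
    moreover have "kelvin p \<kappa> y = U y" using 0 by (simp add: excess_def)
    moreover have l: "0 < factor p \<kappa> y" "factor p \<kappa> y < 1"
      using factor_pos[OF p \<kappa>0 \<kappa>(2)] factor_less_1[OF p \<kappa>] y by auto
    have u: "0 < U y" using U_pos y by simp
    have "factor p \<kappa> y powr (m + 1 - m * q) < 1"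
      using l subcritical by (simp add: powr01_less_one)
    then have "factor p \<kappa> y powr (m + 1 - m * q) * U y powr q < 1 * U y powr q"
      using u by (intro mult_strict_right_mono) auto
    moreover have "(m - a) * (factor p \<kappa> y * U y) \<le> (m - a) * (1 * U y)"
      using a_le l u by (intro mult_left_mono mult_right_mono) auto
    ultimately show False using g(2) by (simp add: algebra_simps)
  qed
  \<comment> \<open>An interior zero would spread over the connected cap and reach the pole \<open>- p\<close> of the sphere.\<close>
  let ?D = "{x \<in> ball 0 1. 0 < gap p \<kappa> x}"
  have "?D = ball 0 1 \<inter> {x. 0 < gap p \<kappa> x}" by auto
  then have openD: "open ?D" using gapopen open_Int[OF open_ball] by metis
  have "excess p \<kappa> x \<noteq> 0"
  proof
    assume 0: "excess p \<kappa> x = 0"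
    then have "norm x \<noteq> 1" using boundary x by blast
    then have xD: "x \<in> ?D" using x by simp
    have zero: "excess p \<kappa> y = 0" if "y \<in> ?D" for y
    proof (rule harmonic_nonneg_strong_min[where w="excess p \<kappa>" and D="?D" and z=x,
          OF openD connected_cap[OF \<kappa>(1)] _ _ xD 0 that])
      show "0 \<le> excess p \<kappa> t" if "t \<in> ?D" for t using dom that by (auto simp: dominates_def)
      show "\<exists>g. has_grad_lap (excess p \<kappa>) g 0 t" if "t \<in> ?D" for t
        using excess_diff[OF p \<kappa>, of t] that by auto
    qed
    have np: "norm (- p) = 1" "0 < gap p \<kappa> (- p)"
      using p \<kappa> by (auto simp: gap_def dot_square_norm)
    have "((\<lambda>t. excess p \<kappa> (t *\<^sub>R (- p))) \<longlongrightarrow> excess p \<kappa> (- p)) (at_left 1)"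
    proof -
      obtain g L where "has_grad_lap (excess p \<kappa>) g L (- p)" using excess_diff[OF p \<kappa>, of "- p"] np by auto
      then have "isCont (excess p \<kappa>) (- p)"
        using has_grad_lap_imp_has_derivative has_derivative_continuous by blast
      moreover have "((\<lambda>t. t *\<^sub>R (- p)) \<longlongrightarrow> 1 *\<^sub>R (- p)) (at_left 1)" by (intro tendsto_intros)
      ultimately show ?thesis using isCont_tendsto_compose by fastforce
    qed
    moreover have "\<forall>\<^sub>F t in at_left 1. excess p \<kappa> (t *\<^sub>R (- p)) = 0"
      using eventually_radial_in_ball[OF np(1) gapopen] np(2) by (auto elim!: eventually_mono intro!: zero)
    then have "((\<lambda>t. excess p \<kappa> (t *\<^sub>R (- p))) \<longlongrightarrow> 0) (at_left 1)" by (rule tendsto_eventually)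
    ultimately have "excess p \<kappa> (- p) = 0" using tendsto_unique trivial_limit_at_left_real by blast
    then show False using boundary np by blast
  qed
  moreover have "0 \<le> excess p \<kappa> x" using dom x by (auto simp: dominates_def)
  ultimately show ?thesis by simp
qed

text \<open>
  For \<open>\<kappa>\<close> near 1 the mirror is a tiny sphere about \<open>p / \<kappa>\<close>. Far from it the weight is so small
  that positivity of \<open>U\<close> suffices, and close to it the Lipschitz continuity of \<open>U\<close> does.
\<close>
lemma dominates_start:
  assumes p: "norm p = 1"
  shows "\<exists>\<kappa>1. 0 < \<kappa>1 \<and> \<kappa>1 < 1 \<and> (\<forall>\<kappa>. \<kappa>1 < \<kappa> \<and> \<kappa> < 1 \<longrightarrow> dominates p \<kappa>)"
proof -
  obtain x0 where x0: "norm x0 \<le> 1" "\<And>x. norm x \<le> 1 \<Longrightarrow> U x0 \<le> U x"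
    using continuous_attains_inf[OF compact_cball _ U_cont] by auto
  obtain x1 where x1: "norm x1 \<le> 1" "\<And>x. norm x \<le> 1 \<Longrightarrow> U x \<le> U x1"
    using continuous_attains_sup[OF compact_cball _ U_cont] by auto
  define \<mu> B where "\<mu> = U x0" and "B = U x1"
  have \<mu>: "0 < \<mu>" "\<mu> \<le> B" using U_pos x0 x1 by (auto simp: \<mu>_def B_def)
  obtain x2 where x2: "norm x2 \<le> 1" "\<And>x. norm x \<le> 1 \<Longrightarrow> norm (G x) \<le> norm (G x2)"
    using continuous_attains_sup[OF compact_cball _ continuous_on_norm[OF G_cont]] by auto
  define Lip where "Lip = norm (G x2)"
  have Lip0: "0 \<le> Lip" by (simp add: Lip_def)
  have Lip: "U y - U x \<le> Lip * norm (y - x)" if xy: "norm x \<le> 1" "norm y \<le> 1" for x y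
  proof -
    have "norm (U y - U x) \<le> Lip * norm (y - x)"
    proof (rule differentiable_bound[of "cball 0 1" U "\<lambda>z h. G z \<bullet> h"])
      show "(U has_derivative (\<lambda>h. G z \<bullet> h)) (at z within cball 0 1)" if "z \<in> cball 0 1" for z
        using U_diff[of z] has_grad_lap_imp_has_derivative has_derivative_at_withinI that by fastforce
      show "onorm ((\<bullet>) (G z)) \<le> Lip" if "z \<in> cball 0 1" for z
      proof (rule onorm_le)
        show "norm (G z \<bullet> h) \<le> Lip * norm h" for h
          using Cauchy_Schwarz_ineq2[of "G z" h] x2(2)[of z] that
          by (smt (verit) Lip_def mem_cball_0 mult_right_mono norm_ge_zero real_norm_def)
      qed
    qed (use xy in auto)
    then show ?thesis by simp
  qed
  \<comment> \<open>Where \<open>factor p \<kappa> x \<le> l0\<close> the Kelvin transform is below the minimum of \<open>U\<close>, whatever \<open>\<kappa>\<close> is.\<close>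
  define l0 where "l0 = (\<mu> / B)\<^sup>2"
  have l0: "0 < l0" "sqrt l0 = \<mu> / B" using \<mu> by (auto simp: l0_def)
  have "((\<lambda>\<kappa>. Lip * (sqrt ((1 - \<kappa>\<^sup>2) / l0) / \<kappa>)) \<longlongrightarrow> Lip * (sqrt ((1 - 1\<^sup>2) / l0) / 1)) (at_left 1)"
    using l0 by (intro tendsto_intros) auto
  then have "\<forall>\<^sub>F \<kappa> in at_left 1. Lip * (sqrt ((1 - \<kappa>\<^sup>2) / l0) / \<kappa>) < \<mu> / 2"
    by (rule order_tendstoD) (use \<mu> in simp)
  then obtain b where b: "b < 1" "\<And>\<kappa>. b < \<kappa> \<Longrightarrow> \<kappa> < 1 \<Longrightarrow> Lip * (sqrt ((1 - \<kappa>\<^sup>2) / l0) / \<kappa>) < \<mu> / 2"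
    by (auto simp: eventually_at_left_field)
  have "dominates p \<kappa>" if \<kappa>: "max b (1 / 2) < \<kappa>" "\<kappa> < 1" for \<kappa>
    unfolding dominates_def
  proof (intro allI impI)
    fix x assume x: "norm x \<le> 1" "0 \<le> gap p \<kappa> x"
    define l where "l = factor p \<kappa> x"
    let ?\<sigma> = "reflect p \<kappa> x"
    have \<kappa>': "0 < \<kappa>" "0 \<le> \<kappa>" "\<kappa> < 1" using \<kappa> by auto
    note facts = p \<kappa>'(2,3) x(1)
    have l: "0 < l" "l \<le> 1" using factor_pos[OF facts] factor_le_1[OF facts x(2)] by (auto simp: l_def)
    have n\<sigma>: "norm ?\<sigma> \<le> 1" by (rule reflect_in_cball(1)[OF facts])
    have lm: "l powr m \<le> sqrt l"
      using powr_mono'[of "1/2" m l] m_ge l by (simp add: powr_half_sqrt)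
    have sl: "sqrt l \<le> 1" using l by simp
    have u\<sigma>: "0 < U ?\<sigma>" "U ?\<sigma> \<le> B" using U_pos n\<sigma> x1 by (auto simp: B_def)
    have ux: "\<mu> \<le> U x" using x0 x by (simp add: \<mu>_def)
    have V: "kelvin p \<kappa> x \<le> sqrt l * U ?\<sigma>"
      unfolding kelvin_def l_def[symmetric] using lm u\<sigma> by (intro mult_right_mono) auto
    show "0 \<le> excess p \<kappa> x"
    proof (cases "l \<le> l0")
      case True
      then have "sqrt l \<le> \<mu> / B" using l0 by (metis real_sqrt_le_iff)
      then have "sqrt l * U ?\<sigma> \<le> (\<mu> / B) * B" using u\<sigma> \<mu> by (intro mult_mono) auto
      then show ?thesis using V ux \<mu> by (simp add: excess_def)
    next
      case False
      \<comment> \<open>Here \<open>x\<close> lies within a bounded multiple of the small radius from the mirror: the reflection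
          moves it by at most \<open>(1 - l) * \<tau>\<close>, and the resulting change of \<open>U\<close> is absorbed by
          the loss \<open>1 - sqrt l \<ge> (1 - l) / 2\<close> in the weight.\<close>
      define \<tau> where "\<tau> = sqrt ((1 - \<kappa>\<^sup>2) / l0) / \<kappa>"
      have d: "0 < mirror_den p \<kappa> x" by (rule mirror_den_pos[OF facts])
      have k2: "0 < 1 - \<kappa>\<^sup>2" using \<kappa>' by (simp add: power_less_one_iff)
      have "norm (?\<sigma> - x) = gap p \<kappa> x / mirror_den p \<kappa> x * sqrt (mirror_den p \<kappa> x)"
        unfolding reflect_minus[OF facts] norm_scaleR
        using x d norm_eq_sqrt_inner[of "p - \<kappa> *\<^sub>R x"] by (simp add: mirror_den_def)
      also have "gap p \<kappa> x / mirror_den p \<kappa> x = (1 - l) / \<kappa>"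
        using one_minus_factor[OF facts] \<kappa>' by (simp add: l_def)
      finally have n: "norm (?\<sigma> - x) = (1 - l) * (sqrt (mirror_den p \<kappa> x) / \<kappa>)" by simp
      have "mirror_den p \<kappa> x = (1 - \<kappa>\<^sup>2) / l" using d k2 by (simp add: l_def factor_def)
      also have "\<dots> \<le> (1 - \<kappa>\<^sup>2) / l0" using False l0 k2 l by (intro divide_left_mono) auto
      finally have "sqrt (mirror_den p \<kappa> x) / \<kappa> \<le> \<tau>" unfolding \<tau>_def using \<kappa>' by (intro divide_right_mono) auto
      then have n: "norm (?\<sigma> - x) \<le> (1 - l) * \<tau>" unfolding n using l by (intro mult_left_mono) auto
      have "Lip * \<tau> \<le> \<mu> / 2" using b(2)[of \<kappa>] \<kappa> by (simp add: \<tau>_def)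
      then have "(1 - l) * (Lip * \<tau>) \<le> (1 - l) * (\<mu> / 2)" using l by (intro mult_left_mono) auto
      moreover have "U ?\<sigma> \<le> U x + Lip * ((1 - l) * \<tau>)"
        using Lip[OF x(1) n\<sigma>] mult_left_mono[OF n Lip0] by linarith
      ultimately have "U ?\<sigma> \<le> U x + (1 - l) * (\<mu> / 2)" by (simp add: mult.left_commute)
      then have "sqrt l * U ?\<sigma> \<le> sqrt l * (U x + (1 - l) * (\<mu> / 2))" using l by (intro mult_left_mono) auto
      also have "\<dots> \<le> sqrt l * U x + (1 - l) * (\<mu> / 2)"
        using sl l \<mu> by (simp add: distrib_left mult_left_le_one_le)
      also have "\<dots> \<le> sqrt l * U x + (1 - sqrt l) * U x"
      proof -
        have "1 - l = (1 - sqrt l) * (1 + sqrt l)" using l by (simp add: algebra_simps)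
        also have "\<dots> \<le> (1 - sqrt l) * 2" using sl by (intro mult_left_mono) auto
        finally have "(1 - l) * (\<mu> / 2) \<le> (1 - sqrt l) * 2 * (\<mu> / 2)" using \<mu> by (intro mult_right_mono) auto
        also have "\<dots> = (1 - sqrt l) * \<mu>" by simp
        also have "\<dots> \<le> (1 - sqrt l) * U x" using ux sl by (intro mult_left_mono) auto
        finally show ?thesis by simp
      qed
      also have "\<dots> = U x" by (simp add: algebra_simps)
      finally show ?thesis using V by (simp add: excess_def)
    qed
  qed
  then show ?thesis using b by (intro exI[of _ "max b (1/2)"]) auto
qed

text \<open>
  Where the Kelvin transform exceeds \<open>U\<close>, the boundary condition still gives a lower bound for the
  normal derivative that is linear in the difference, with a constant independent of \<open>\<kappa>\<close>; it
  comes from the mean value theorem for \<open>t powr q\<close>. The linear terms only help, because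
  \<open>0 \<le> a \<le> m\<close>.
\<close>
lemma robin_linearization:
  assumes b: "0 \<le> b" "\<And>x. norm x \<le> 1 \<Longrightarrow> U x \<le> b"
    and p: "norm p = 1" and \<kappa>: "0 < \<kappa>" "\<kappa> < 1" and x: "norm x = 1" "0 \<le> gap p \<kappa> x" "excess p \<kappa> x < 0"
  shows "q * b powr (q - 1) * excess p \<kappa> x \<le> U x powr q - a * U x + m * kelvin p \<kappa> x
        - factor p \<kappa> x powr (m + 1 - m * q) * kelvin p \<kappa> x powr q - (m - a) * (factor p \<kappa> x * kelvin p \<kappa> x)"
    (is "_ \<le> ?R")
proof -
  have facts: "norm p = 1" "0 \<le> \<kappa>" "\<kappa> < 1" "norm x \<le> 1" using p \<kappa> x by auto
  let ?l = "factor p \<kappa> x" and ?v = "kelvin p \<kappa> x"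
  have l: "0 < ?l" "?l \<le> 1" using factor_pos[OF facts] factor_le_1[OF facts x(2)] by auto
  have u: "0 < U x" and v: "0 < ?v" and uv: "U x < ?v"
    using U_pos kelvin_pos[OF facts] x by (auto simp: excess_def)
  have "?v \<le> 1 * b"
    unfolding kelvin_def using l m_ge b U_pos[OF reflect_in_cball(1)[OF facts]] reflect_in_cball(1)[OF facts]
    by (intro mult_mono powr_le1) auto
  then have vb: "?v \<le> b" by simp
  have "?l powr (m + 1 - m * q) \<le> 1" using l subcritical by (intro powr_le1) auto
  then have "?l powr (m + 1 - m * q) * ?v powr q \<le> 1 * ?v powr q" by (intro mult_right_mono) auto
  moreover have "(m - a) * (?l * ?v) \<le> (m - a) * (1 * ?v)"
    using a_le l v by (intro mult_left_mono mult_right_mono) auto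
  ultimately have "U x powr q - ?v powr q - a * excess p \<kappa> x \<le> ?R" by (simp add: excess_def algebra_simps)
  moreover have "q * b powr (q - 1) * excess p \<kappa> x \<le> U x powr q - ?v powr q"
  proof -
    have "\<exists>z>U x. z < ?v \<and> ?v powr q - U x powr q = (?v - U x) * (q * z powr (q - 1))"
      by (rule MVT2[OF uv]) (use u in \<open>auto intro!: has_real_derivative_powr\<close>)
    then obtain z where z: "U x < z" "z < ?v" "?v powr q - U x powr q = (?v - U x) * (q * z powr (q - 1))"
      by blast
    have "z powr (q - 1) \<le> b powr (q - 1)" using z u vb q_gt by (intro powr_mono2) auto
    then have "(?v - U x) * (q * z powr (q - 1)) \<le> (?v - U x) * (q * b powr (q - 1))"
      using uv q_gt by (intro mult_left_mono) auto
    then show ?thesis using z(3) by (simp add: excess_def algebra_simps)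
  qed
  moreover have "0 \<le> - a * excess p \<kappa> x" using a_nonneg x by (simp add: mult_nonneg_nonpos)
  ultimately show ?thesis by linarith
qed

text \<open>
  Off the mirror the inequality is strict and therefore stable. On the mirror both sides agree, so
  there the strictness is lost; in a thin region along it, comparison with the barrier takes its place.
  At a touching point inside the ball the barrier is strictly superharmonic, and on the sphere its normal
  derivative beats the linearized boundary term.
\<close>
lemma dominates_open:
  assumes p: "norm p = 1" and \<kappa>0: "0 < \<kappa>0" "\<kappa>0 < 1" and dom: "dominates p \<kappa>0"
  shows "\<exists>\<delta>>0. \<forall>\<kappa>. 0 < \<kappa> \<and> \<kappa>0 - \<delta> < \<kappa> \<and> \<kappa> \<le> \<kappa>0 \<longrightarrow> dominates p \<kappa>"
proof -
  obtain x1 where x1: "norm x1 \<le> 1" "\<And>x. norm x \<le> 1 \<Longrightarrow> U x \<le> U x1"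
    using continuous_attains_sup[OF compact_cball _ U_cont] by auto
  define C where "C = q * U x1 powr (q - 1)"
  have C: "0 \<le> C" using q_gt by (simp add: C_def)
  define k where "k = C + 1"
  \<comment> \<open>\<open>C\<close> is the constant of the linearized boundary inequality; \<open>k = C + 1\<close> makes the logarithmic
      normal derivative of the barrier exceed \<open>C\<close>, and \<open>K\<close> bounds the Laplacian of its exponential
      part, which \<open>M\<close> then has to beat.\<close>
  define K where "K = 2 * k * DIM('a) + 4 * k\<^sup>2"
  have K: "0 \<le> K" "1 \<le> k" using C by (auto simp: K_def k_def)
  define M where "M = (K + 1) / (1 - \<kappa>0)\<^sup>2"
  have "(1 - \<kappa>0)\<^sup>2 \<le> 1" "0 < (1 - \<kappa>0)\<^sup>2" using \<kappa>0 by (auto simp: power_le_one)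
  then have MK: "M * (1 - \<kappa>0)\<^sup>2 = K + 1" "1 \<le> M"
    using K by (auto simp: M_def le_divide_eq)
  then have M: "1 \<le> M" "K < 8 * M * (1 - \<kappa>0)\<^sup>2"
    using K by (auto simp: mult.assoc)
  define \<epsilon> where "\<epsilon> = 1 / (2 * M)"
  have \<epsilon>: "0 < \<epsilon>" "M * \<epsilon>\<^sup>2 \<le> 1 / 2" using M by (auto simp: \<epsilon>_def power2_eq_square field_simps)
  let ?H = "\<lambda>y. excess p (fst y) (snd y)"
  have "uniformly_continuous_on ({0..\<kappa>0} \<times> cball 0 1) ?H"
    using excess_cont[OF p \<kappa>0(2)] by (intro compact_uniformly_continuous compact_Times) auto
  note unif = this[unfolded uniformly_continuous_on_def, rule_format]
  \<comment> \<open>Away from the mirror strict positivity survives a small change of \<open>\<kappa>\<close>, by compactness.\<close>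
  define A where "A = {x \<in> cball 0 1. \<epsilon> \<le> gap p \<kappa>0 x}"
  have "\<exists>\<eta>>0. \<forall>x\<in>A. \<eta> \<le> excess p \<kappa>0 x"
  proof (cases "A = {}")
    case False
    have "A = cball 0 1 \<inter> {x. \<epsilon> \<le> gap p \<kappa>0 x}" by (auto simp: A_def)
    moreover have "closed {x. \<epsilon> \<le> gap p \<kappa>0 x}"
      using continuous_on_gap[of UNIV p \<kappa>0] by (intro closed_Collect_le continuous_on_const)
    ultimately have "compact A" using compact_Int_closed[OF compact_cball] by metis
    moreover have "continuous_on A (excess p \<kappa>0)"
      by (rule continuous_on_subset[OF excess_cont_space]) (use p \<kappa>0 in \<open>auto simp: A_def\<close>)
    ultimately obtain z where z: "z \<in> A" "\<And>x. x \<in> A \<Longrightarrow> excess p \<kappa>0 z \<le> excess p \<kappa>0 x"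
      using continuous_attains_inf[of A "excess p \<kappa>0"] False by blast
    moreover have "0 < excess p \<kappa>0 z"
      using z(1) \<epsilon> by (intro dominates_strict[OF p \<kappa>0 dom]) (auto simp: A_def)
    ultimately show ?thesis by blast
  qed (auto intro: exI[of _ 1])
  then obtain \<eta> where \<eta>: "0 < \<eta>" "\<And>x. x \<in> A \<Longrightarrow> \<eta> \<le> excess p \<kappa>0 x" by blast
  obtain \<delta> where \<delta>: "0 < \<delta>" "\<And>y y'. y \<in> {0..\<kappa>0} \<times> cball 0 1 \<Longrightarrow> y' \<in> {0..\<kappa>0} \<times> cball 0 1 \<Longrightarrow>
      dist y' y < \<delta> \<Longrightarrow> dist (?H y') (?H y) < \<eta>"
    using unif[OF \<eta>(1)] by blast
  have "dominates p \<kappa>" if \<kappa>: "0 < \<kappa>" "\<kappa>0 - \<delta> < \<kappa>" "\<kappa> \<le> \<kappa>0" for \<kappa>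
  proof -
    have \<kappa>': "0 \<le> \<kappa>" "\<kappa> < 1" using \<kappa> \<kappa>0 by auto
    have far: "0 < excess p \<kappa> x" if x: "norm x \<le> 1" "\<epsilon> \<le> gap p \<kappa> x" for x
    proof -
      have "x \<in> A" using x gap_mono[OF \<kappa>(3), of p x] by (simp add: A_def)
      moreover have "dist (?H (\<kappa>, x)) (?H (\<kappa>0, x)) < \<eta>"
        using \<kappa> \<kappa>0 x by (intro \<delta>(2)) (auto simp: dist_Pair_Pair dist_real_def)
      ultimately show ?thesis using \<eta>(2)[of x] by (auto simp: dist_real_def)
    qed
    \<comment> \<open>Next to the mirror, and up to the corner where it meets the sphere, the barrier takes over.\<close>
    define E where "E = {x \<in> cball 0 1. 0 \<le> gap p \<kappa> x \<and> gap p \<kappa> x \<le> \<epsilon>}"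
    define \<phi> where "\<phi> = (\<lambda>x. 1 + exp (k * (x \<bullet> x - 1)) - M * (gap p \<kappa> x * gap p \<kappa> x))"
    have sq: "M * (gap p \<kappa> x)\<^sup>2 \<le> 1 / 2" if "x \<in> E" for x
    proof -
      have "M * (gap p \<kappa> x)\<^sup>2 \<le> M * \<epsilon>\<^sup>2"
        using that M by (intro mult_left_mono power_mono) (auto simp: E_def)
      then show ?thesis using \<epsilon> by simp
    qed
    have near: "0 \<le> excess p \<kappa> x" if "x \<in> E" for x
    proof (rule minimum_comparison[of E "excess p \<kappa>" \<phi>, OF _ _ _ _ _ that])
      have "E = cball 0 1 \<inter> ({x. 0 \<le> gap p \<kappa> x} \<inter> {x. gap p \<kappa> x \<le> \<epsilon>})" by (auto simp: E_def)
      moreover have "closed ({x. 0 \<le> gap p \<kappa> x} \<inter> {x. gap p \<kappa> x \<le> \<epsilon>})"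
        using continuous_on_gap[of UNIV p \<kappa>] by (intro closed_Int closed_Collect_le continuous_on_const)
      ultimately show "compact E" using compact_Int_closed[OF compact_cball] by metis
      show "continuous_on E (excess p \<kappa>)"
        by (rule continuous_on_subset[OF excess_cont_space[OF p \<kappa>']]) (auto simp: E_def)
      show "continuous_on E \<phi>" unfolding \<phi>_def by (intro continuous_intros continuous_on_gap)
      show "0 < \<phi> x" if "x \<in> E" for x
      proof -
        have "0 < exp (k * (x \<bullet> x - 1))" by simp
        then show ?thesis using sq[OF that] unfolding \<phi>_def power2_eq_square by linarith
      qed
    next
      fix x \<theta>
      assume x: "x \<in> E" and neg: "excess p \<kappa> x < 0" and \<theta>: "0 < \<theta>" and eq: "excess p \<kappa> x + \<theta> * \<phi> x = 0"
        and min: "\<And>y. y \<in> E \<Longrightarrow> 0 \<le> excess p \<kappa> y + \<theta> * \<phi> y"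
      have nx: "norm x \<le> 1" using x by (simp add: E_def)
      have "gap p \<kappa> x \<noteq> 0" using kelvin_gap_zero[OF p \<kappa>' nx] neg by (auto simp: excess_def)
      moreover have "\<not> \<epsilon> \<le> gap p \<kappa> x" using far[OF nx] neg by fastforce
      ultimately have s: "0 < gap p \<kappa> x" "gap p \<kappa> x < \<epsilon>" using x by (auto simp: E_def)
      define S where "S = {x. 0 < gap p \<kappa> x} \<inter> {x. gap p \<kappa> x < \<epsilon>}"
      have S: "open S" "x \<in> S" unfolding S_def
        using s continuous_on_gap[of UNIV p \<kappa>] by (auto intro!: open_Int open_Collect_less continuous_on_const)
      obtain g L where g: "has_grad_lap (excess p \<kappa>) g L x" "norm x < 1 \<longrightarrow> L = 0"
        "norm x = 1 \<longrightarrow> g \<bullet> x = U x powr q - a * U x + m * kelvin p \<kappa> x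
          - factor p \<kappa> x powr (m + 1 - m * q) * kelvin p \<kappa> x powr q - (m - a) * (factor p \<kappa> x * kelvin p \<kappa> x)"
        using excess_diff[OF p \<kappa>(1) \<kappa>'(2) nx] by blast
      obtain h J where h: "has_grad_lap \<phi> h J x"
          "J \<le> 2 * k * DIM('a) + 4 * k\<^sup>2 - 8 * M * (1 - \<kappa>)\<^sup>2"
          "norm x = 1 \<longrightarrow> h \<bullet> x = 2 * k - 2 * M * (gap p \<kappa> x)\<^sup>2"
        using barrier[OF p \<kappa>(1) \<kappa>'(2) nx, of k M] K(2) M(1) s(1) unfolding \<phi>_def by fastforce
      have sum: "has_grad_lap (\<lambda>x. excess p \<kappa> x + \<theta> * \<phi> x) (g + \<theta> *\<^sub>R h) (L + \<theta> * J) x"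
        by (intro has_grad_lap_add has_grad_lap_cmult g h)
      show False
      proof (cases "norm x < 1")
        case True
        have "open (ball 0 1 \<inter> S)" "x \<in> ball 0 1 \<inter> S" using S True by auto
        moreover have "ball 0 1 \<inter> S \<subseteq> E" by (auto simp: E_def S_def)
        ultimately have "\<forall>\<^sub>F y in nhds x. y \<in> E" by (meson eventually_nhds subsetD)
        then have "\<forall>\<^sub>F y in nhds x. excess p \<kappa> x + \<theta> * \<phi> x \<le> excess p \<kappa> y + \<theta> * \<phi> y"
          by eventually_elim (use min eq in simp)
        from has_grad_lap_local_min[OF sum this] have "0 \<le> \<theta> * J" using g(2) True by simp
        moreover have "(1 - \<kappa>0)\<^sup>2 \<le> (1 - \<kappa>)\<^sup>2" using \<kappa> \<kappa>0 by (intro power_mono) auto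
        then have "8 * M * (1 - \<kappa>0)\<^sup>2 \<le> 8 * M * (1 - \<kappa>)\<^sup>2" using M by (intro mult_left_mono) auto
        then have "J < 0" using h(2) M(2) unfolding K_def by linarith
        ultimately show False using \<theta> by (simp add: zero_le_mult_iff)
      next
        case False
        then have n1: "norm x = 1" using nx by simp
        have "\<forall>\<^sub>F t in at_left 1. excess p \<kappa> x + \<theta> * \<phi> x \<le> excess p \<kappa> (t *\<^sub>R x) + \<theta> * \<phi> (t *\<^sub>R x)"
          using eventually_radial_in_ball[OF n1 S]
        proof eventually_elim
          case (elim t)
          then show ?case unfolding eq by (intro min) (auto simp: E_def S_def)
        qed
        from radial_derivative_nonpos[OF has_grad_lap_imp_has_derivative[OF sum] this]
        have "g \<bullet> x + \<theta> * (h \<bullet> x) \<le> 0" by (simp add: inner_add_left)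
        moreover have "C * excess p \<kappa> x \<le> g \<bullet> x"
          unfolding C_def g(3)[rule_format, OF n1]
          by (rule robin_linearization[OF less_imp_le[OF U_pos[OF x1(1)]] x1(2) p \<kappa>(1) \<kappa>'(2) n1
                less_imp_le[OF s(1)] neg])
        moreover have "excess p \<kappa> x = - (\<theta> * \<phi> x)" using eq by simp
        ultimately have small: "\<theta> * (h \<bullet> x - C * \<phi> x) \<le> 0" by (simp add: algebra_simps)
        have "C * \<phi> x \<le> C * 2"
          using C M n1 by (intro mult_left_mono) (auto simp: \<phi>_def dot_square_norm)
        moreover have "h \<bullet> x \<ge> 2 * C + 1" using h(3) n1 sq[OF x] by (simp add: k_def algebra_simps)
        ultimately have "0 < h \<bullet> x - C * \<phi> x" by linarith
        with \<theta> have "0 < \<theta> * (h \<bullet> x - C * \<phi> x)" by (rule mult_pos_pos)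
        then show False using small by linarith
      qed
    qed
    show ?thesis
      unfolding dominates_def
    proof (intro allI impI)
      fix x assume "norm x \<le> 1" "0 \<le> gap p \<kappa> x"
      then show "0 \<le> excess p \<kappa> x"
        using near[of x] far[of x] by (cases "gap p \<kappa> x \<le> \<epsilon>") (auto simp: E_def)
    qed
  qed
  then show ?thesis using \<delta>(1) by blast
qed

text \<open>
  The method of moving spheres: start near \<open>\<kappa> = 1\<close> and decrease \<open>\<kappa>\<close>; the supremum of the bad
  parameters is good by closedness, and then so are the parameters just below it.
\<close>
lemma dominates_all:
  assumes p: "norm p = 1" and \<kappa>: "0 < \<kappa>" "\<kappa> < 1"
  shows "dominates p \<kappa>"
proof (rule ccontr)
  assume bad: "\<not> ?thesis"
  define B where "B = {t. 0 < t \<and> t < 1 \<and> \<not> dominates p t}"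
  obtain \<kappa>1 where \<kappa>1: "0 < \<kappa>1" "\<kappa>1 < 1" "\<And>t. \<kappa>1 < t \<Longrightarrow> t < 1 \<Longrightarrow> dominates p t"
    using dominates_start[OF p] by blast
  have B: "\<kappa> \<in> B" "\<And>t. t \<in> B \<Longrightarrow> t \<le> \<kappa>1" using bad \<kappa> \<kappa>1 by (auto simp: B_def not_less[symmetric])
  define s where "s = Sup B"
  have bdd: "bdd_above B" using B by (auto simp: bdd_above_def)
  have s: "\<kappa> \<le> s" "s \<le> \<kappa>1" using cSup_upper[OF B(1) bdd] cSup_least[of B \<kappa>1] B by (auto simp: s_def)
  have s01: "0 < s" "s < 1" using s \<kappa> \<kappa>1 by auto
  have above: "dominates p t" if "s < t" "t < 1" for t
  proof (rule ccontr)
    assume "\<not> dominates p t"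
    then have "t \<in> B" using that s01 by (simp add: B_def)
    then have "t \<le> s" unfolding s_def using bdd by (rule cSup_upper)
    then show False using that by simp
  qed
  have "dominates p s" by (rule dominates_closed[OF p _ s01(2) above]) (use s01 in auto)
  from dominates_open[OF p s01 this] obtain \<delta> where \<delta>: "\<delta> > 0"
    "\<And>t. 0 < t \<Longrightarrow> s - \<delta> < t \<Longrightarrow> t \<le> s \<Longrightarrow> dominates p t" by blast
  obtain t where t: "t \<in> B" "s - \<delta> < t" using less_cSupD[of B "s - \<delta>"] B(1) \<delta>(1) unfolding s_def by force
  then show False using above[of t] \<delta>(2)[of t] by (cases "t \<le> s") (auto simp: B_def)
qed

section \<open>Symmetry and constancy\<close>

lemma dominates_zero:
  assumes dom: "dominates p 0" and p: "norm p = 1" and x: "norm x \<le> 1" "p \<bullet> x \<le> 0"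
  shows "U (x - (2 * (p \<bullet> x)) *\<^sub>R p) \<le> U x"
proof -
  have d: "mirror_den p 0 x = 1" using p by (simp add: mirror_den_def dot_square_norm)
  have "reflect p 0 x = x - (2 * (p \<bullet> x)) *\<^sub>R p" "factor p 0 x = 1" "0 \<le> gap p 0 x"
    using x by (auto simp: reflect_def factor_def d gap_def)
  then show ?thesis using dom x by (auto simp: dominates_def excess_def kelvin_def)
qed

text \<open>
  Two distinct points of the sphere are exchanged by the reflection in the hyperplane orthogonal to
  \<open>y - x\<close>, which is the limit \<open>\<kappa> = 0\<close> of the moving mirrors.
\<close>
lemma U_sphere_le:
  assumes x: "norm x = 1" and y: "norm y = 1"
  shows "U y \<le> U x"
proof (cases "x = y")
  case False
  define p where "p = (1 / norm (y - x)) *\<^sub>R (y - x)"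
  have n: "norm (y - x) \<noteq> 0" using False by simp
  have p: "norm p = 1" using n by (simp add: p_def)
  have xx: "x \<bullet> x = 1" "y \<bullet> y = 1" using x y by (auto simp: dot_square_norm)
  have sq: "(norm (y - x))\<^sup>2 = - 2 * ((y - x) \<bullet> x)"
    using xx by (simp add: dot_square_norm[symmetric] inner_diff_left inner_diff_right inner_commute)
  have px: "p \<bullet> x = - norm (y - x) / 2"
  proof -
    have "(y - x) \<bullet> x = - (norm (y - x) * norm (y - x)) / 2" using sq by (simp add: power2_eq_square)
    then show ?thesis using n unfolding p_def inner_scaleR_left by simp
  qed
  have "x - (2 * (p \<bullet> x)) *\<^sub>R p = y" unfolding px using n by (simp add: p_def)
  moreover have "dominates p 0" by (rule dominates_closed[OF p _ _ dominates_all[OF p]]) auto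
  from dominates_zero[OF this p, of x] have "U (x - (2 * (p \<bullet> x)) *\<^sub>R p) \<le> U x" using x px by simp
  ultimately show ?thesis by simp
qed simp

lemma U_constant:
  assumes x: "norm x \<le> 1" and e: "norm e = 1"
  shows "U x = U e"
proof -
  have bd: "U y = U e" if "norm y = 1" for y
    using U_sphere_le[OF that e] U_sphere_le[OF e that] by simp
  have "0 \<le> U x - U e"
  proof (rule harmonic_nonneg_from_boundary[of "\<lambda>x. U x - U e", OF _ _ _ x])
    show "\<exists>g. has_grad_lap (\<lambda>x. U x - U e) g 0 x" if "norm x < 1" for x
      using has_grad_lap_diff[OF U_harmonic[OF that] has_grad_lap_const[of "U e"]] by auto
  qed (use bd in \<open>auto intro!: continuous_intros U_cont\<close>)
  moreover have "0 \<le> U e - U x"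
  proof (rule harmonic_nonneg_from_boundary[of "\<lambda>x. U e - U x", OF _ _ _ x])
    show "\<exists>g. has_grad_lap (\<lambda>x. U e - U x) g 0 x" if "norm x < 1" for x
      using has_grad_lap_diff[OF has_grad_lap_const[of "U e"] U_harmonic[OF that]] by auto
  qed (use bd in \<open>auto intro!: continuous_intros U_cont\<close>)
  ultimately show ?thesis by simp
qed

end

theorem theorem4:
  fixes u :: "real ^ 'n::finite \<Rightarrow> real" and q a :: real
  assumes "CARD('n) \<ge> 3"
    and "1 < q" and "q < real CARD('n) / (real CARD('n) - 2)"
    and "0 < a" and "a \<le> (real CARD('n) - 2) / 2"
    and "smooth_on_closed_ball u"
    and "\<forall>x\<in>cball 0 1. u x > 0"
    and "\<forall>x\<in>ball 0 1. laplacian u x = 0"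
    and "\<forall>x\<in>sphere 0 1. outer_normal_deriv u x + a * u x = u x powr q"
  shows "u constant_on cball 0 1"
proof -
  obtain S v where S: "cball 0 1 \<subseteq> S" "smooth_on_open v S" and vu: "\<And>x. x \<in> cball 0 1 \<Longrightarrow> v x = u x"
    using assms(6) by (auto simp: smooth_on_closed_ball_def)
  have openS: "open S" and C2: "Ck_on 2 v S" using S(2) by (auto simp: smooth_on_open_def)
  define G where "G = (\<lambda>x. \<Sum>i\<in>UNIV. partial_deriv i v x *\<^sub>R axis i (1::real))"
  have gl: "has_grad_lap v (G x) (laplacian v x) x" if "x \<in> S" for x
    unfolding G_def by (rule Ck_on_2_has_grad_lap[OF openS that C2])
  interpret positive_robin_solution v G q a "(real CARD('n) - 2) / 2"
  proof
    show "1 / 2 \<le> (real CARD('n) - 2) / 2" using assms(1) by simp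
    have "q * (real CARD('n) - 2) < real CARD('n)" using assms(1,3) by (simp add: pos_less_divide_eq)
    then show "(real CARD('n) - 2) / 2 * q < (real CARD('n) - 2) / 2 + 1" by (simp add: field_simps)
    show "0 < v x" if "norm x \<le> 1" for x using that assms(7) vu by simp
    show "\<exists>L. has_grad_lap v (G x) L x" if "norm x \<le> 1" for x using gl[of x] S(1) that mem_cball_0 by blast
    show "has_grad_lap v (G x) 0 x" if "norm x < 1" for x
    proof -
      have "laplacian v x = laplacian u x" by (rule laplacian_cong[of "ball 0 1"]) (use that vu in auto)
      moreover have "x \<in> S" using S(1) that by (auto simp: subset_iff)
      ultimately show ?thesis using gl[of x] that assms(8) by simp
    qed
    have "continuous_on (cball 0 1) (partial_deriv i v)" for i
    proof (intro continuous_at_imp_continuous_on ballI)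
      fix x :: "real ^ 'n" assume "x \<in> cball 0 1"
      then have "x \<in> S" using S(1) by blast
      then have "partial_deriv i v differentiable (at x)" using C2 by (simp add: numeral_2_eq_2)
      then show "isCont (partial_deriv i v) x" by (rule differentiable_imp_continuous_within)
    qed
    then show "continuous_on (cball 0 1) G"
      unfolding G_def by (intro continuous_on_sum continuous_on_scaleR continuous_on_const)
    show "G x \<bullet> x + a * v x = v x powr q" if "norm x = 1" for x
    proof -
      have d: "(v has_derivative (\<lambda>h. G x \<bullet> h)) (at x)"
        using S(1) that by (intro has_grad_lap_imp_has_derivative[OF gl]) (auto simp: subset_iff)
      have "outer_normal_deriv u x = frechet_derivative v (at x) x"
        by (rule outer_normal_deriv_extension) (use that d vu in \<open>auto simp: differentiable_def\<close>)
      then have "outer_normal_deriv u x = G x \<bullet> x" using frechet_derivative_at[OF d] by simp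
      moreover have "outer_normal_deriv u x + a * u x = u x powr q" using assms(9) that by simp
      ultimately show ?thesis using that vu[of x] by simp
    qed
  qed (use assms in auto)
  define e :: "real ^ 'n" where "e = axis undefined 1"
  have e: "norm e = 1" by (simp add: e_def)
  have "u x = v e" if "x \<in> cball 0 1" for x
    using U_constant[OF _ e, of x] vu[OF that] that by simp
  then show ?thesis unfolding constant_on_def by blast
qed

end
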